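(* Let $k\ge1$, $n\ge2k+1$, and let $T$ be a $k$-triangulation of the $n$-gon with oriented dual multigraph $T^\#$. Then the cone of $\Omega_{n,k}$ at $\psi(T)$, i.e. the cone $\{\lambda(x-\psi(T)):\lambda\ge0,\ x\in\Omega_{n,k}\}$, equals the incidence cone of $T^\#$, i.e. the cone generated by the vectors $e_i-e_j$ over all oriented edges $i\to j$ of $T^\#$ (where $e_1,\dots,e_{n-2k}$ is the canonical basis of $\mathbb{R}^{n-2k}$).
   Context: Let $V_n=\{0,\dots,n-1\}$ be the vertices of a convex $n$-gon, $E_n$ its edges $[u,v]$. Two edges cross if their endpoints are distinct and alternate cyclically; an $\ell$-crossing is a set of $\ell$ pairwise crossing edges. A $k$-triangulation is a maximal subset of $E_n$ with no $(k+1)$-crossing. An edge $[u,v]$ is $k$-relevant if $\min(|u-v|,n-|u-v|)>k$. A $k$-star is the set of edges $\{[s_j,s_{j+k}]: j\in\mathbb{Z}_{2k+1}\}$ for vertices $s_1<\dots<s_{2k+1}$. Every $k$-triangulation $T$ is the union of exactly $n-2k$ $k$-stars; for each $i\in\{1,\dots,n-2k\}$ the $i$-th $k$-star of $T$ is the unique one whose $(k+1)$-th smallest vertex is $k-1+i$; each $k$-relevant edge of $T$ lies in exactly two of these $k$-stars. The beam vector $\psi(T)\in\mathbb{R}^{n-2k}$ has $i$-th coordinate $\sum_{j=1}^k (s_{j+1}-s_j)(s_{k+1+j}-s_{k+1})$, where $s_1<\dots<s_{2k+1}$ are the vertices of the $i$-th $k$-star, and $\Omega_{n,k}$ is the convex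 hull of the beam vectors of all $k$-triangulations of the $n$-gon. Beam arrangement: place a mirror at each lattice point $(u,v)$ with $u<v$ and $[u,v]\in T$. For $i=1,\dots,n-2k$, the beam $B_i$ starts at $(-\infty,k-1+i)$ moving rightward; a beam moving rightward along the line $y=v$ that reaches a mirror $(u,v)$ turns to move upward along $x=u$, and a beam moving upward along $x=u$ that reaches a mirror $(u,v)$ turns to move rightward along $y=v$. The beam $B_i$ reflects exactly at the mirrors given by the edges of the $i$-th $k$-star of $T$, and at each mirror corresponding to a $k$-relevant edge exactly two beams reflect, one arriving there moving upward and one arriving moving rightward. The oriented dual multigraph $T^\#$ has vertex set $\{1,\dots,n-2k\}$ and, for each $k$-relevant edge $[u,v]$ of $T$, one oriented edge from the index of the beam arriving at $(u,v)$ moving upward to the index of the beam arriving at $(u,v)$ moving rightward. *)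

theory Defs
  imports "HOL-Analysis.Analysis" "Graph_Theory.Digraph"
begin

text \<open>
  The edge \<open>[u,v]\<close> of the polygon on the vertices \<open>0, \<dots>, n - 1\<close> is represented by the ordered
  pair of its endpoints, smaller one first.
\<close>

type_synonym edge = "nat \<times> nat"

definition edge_between :: "nat \<Rightarrow> nat \<Rightarrow> edge" where
  "edge_between u v = (min u v, max u v)"

definition polygon_edges :: "nat \<Rightarrow> edge set" where
  "polygon_edges n = {(u, v). u < v \<and> v < n}"

fun crosses :: "edge \<Rightarrow> edge \<Rightarrow> bool" where
  "crosses (a, b) (c, d) \<longleftrightarrow> (a < c \<and> c < b \<and> b < d) \<or> (c < a \<and> a < d \<and> d < b)"

definition crossing :: "nat \<Rightarrow> edge set \<Rightarrow> bool" where
  "crossing l X \<longleftrightarrow> finite X \<and> card X = l \<and> pairwise crosses X"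

definition crossing_free :: "nat \<Rightarrow> edge set \<Rightarrow> bool" where
  "crossing_free l F \<longleftrightarrow> \<not> (\<exists>X\<subseteq>F. crossing l X)"

definition k_triangulation :: "nat \<Rightarrow> nat \<Rightarrow> edge set \<Rightarrow> bool" where
  "k_triangulation n k T \<longleftrightarrow>
     T \<subseteq> polygon_edges n \<and> crossing_free (k + 1) T \<and>
     (\<forall>F. T \<subseteq> F \<and> F \<subseteq> polygon_edges n \<and> crossing_free (k + 1) F \<longrightarrow> F = T)"

definition k_relevant :: "nat \<Rightarrow> nat \<Rightarrow> edge \<Rightarrow> bool" where
  "k_relevant n k = (\<lambda>(u, v). min (v - u) (n - (v - u)) > k)"

text \<open>
  A \<open>k\<close>-star is given by the increasing list \<open>s\<close> of its \<open>2k + 1\<close> vertices. Lists are indexed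
  from \<open>0\<close>, so the vertex usually called \<open>s\<^sub>j\<close> is \<open>s ! (j - 1)\<close>.
\<close>

definition star_edges :: "nat \<Rightarrow> nat list \<Rightarrow> edge set" where
  "star_edges k s =
     {edge_between (s ! j) (s ! ((j + k) mod (2 * k + 1))) | j. j < 2 * k + 1}"

definition k_star_of :: "nat \<Rightarrow> nat \<Rightarrow> edge set \<Rightarrow> nat list \<Rightarrow> bool" where
  "k_star_of n k T s \<longleftrightarrow>
     length s = 2 * k + 1 \<and> sorted_wrt (<) s \<and> set s \<subseteq> {..<n} \<and> star_edges k s \<subseteq> T"

definition nth_star :: "nat \<Rightarrow> nat \<Rightarrow> edge set \<Rightarrow> nat \<Rightarrow> nat list" where
  "nth_star n k T i = (THE s. k_star_of n k T s \<and> s ! k = k - 1 + i)"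

definition beam_coord :: "nat \<Rightarrow> nat \<Rightarrow> edge set \<Rightarrow> nat \<Rightarrow> real" where
  "beam_coord n k T i =
     (let s = nth_star n k T i
      in \<Sum>j = 1..k. (real (s ! j) - real (s ! (j - 1))) * (real (s ! (k + j)) - real (s ! k)))"

text \<open>
  The space of dimension \<open>n - 2k\<close> is \<open>real ^ 'm\<close>, with a bijection \<open>ix\<close> from \<open>{1..n - 2 * k}\<close> to
  \<open>'m\<close> numbering the coordinates; the \<open>i\<close>-th canonical basis vector is \<open>axis (ix i) 1\<close>.
\<close>

definition beam_vector :: "(nat \<Rightarrow> 'm::finite) \<Rightarrow> nat \<Rightarrow> nat \<Rightarrow> edge set \<Rightarrow> real ^ 'm" where
  "beam_vector ix n k T = (\<Sum>i = 1..n - 2 * k. beam_coord n k T i *\<^sub>R axis (ix i) 1)"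

definition beam_polytope :: "(nat \<Rightarrow> 'm::finite) \<Rightarrow> nat \<Rightarrow> nat \<Rightarrow> (real ^ 'm) set" where
  "beam_polytope ix n k = convex hull {beam_vector ix n k T | T. k_triangulation n k T}"

definition mirrors :: "edge set \<Rightarrow> (int \<times> int) set" where
  "mirrors T = {(int u, int v) | u v. u < v \<and> (u, v) \<in> T}"

datatype direction = Rightward | Upward

text \<open>
  \<open>beam_arrives k T i p d\<close>: the \<open>i\<close>-th beam arrives at the lattice point \<open>p\<close> moving in direction
  \<open>d\<close>. No mirror has a negative abscissa, so coming from \<open>-\<infinity>\<close> along the line \<open>y = k - 1 + i\<close> the
  beam arrives rightward at every point of that line with negative abscissa.
\<close>

inductive beam_arrives :: "nat \<Rightarrow> edge set \<Rightarrow> nat \<Rightarrow> int \<times> int \<Rightarrow> direction \<Rightarrow> bool"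
  for k :: nat and T :: "edge set" and i :: nat
where
  start: "x < 0 \<Longrightarrow> beam_arrives k T i (x, int k - 1 + int i) Rightward"
| right_pass: "beam_arrives k T i (x, y) Rightward \<Longrightarrow> (x, y) \<notin> mirrors T
    \<Longrightarrow> beam_arrives k T i (x + 1, y) Rightward"
| right_reflect: "beam_arrives k T i (x, y) Rightward \<Longrightarrow> (x, y) \<in> mirrors T
    \<Longrightarrow> beam_arrives k T i (x, y + 1) Upward"
| up_pass: "beam_arrives k T i (x, y) Upward \<Longrightarrow> (x, y) \<notin> mirrors T
    \<Longrightarrow> beam_arrives k T i (x, y + 1) Upward"
| up_reflect: "beam_arrives k T i (x, y) Upward \<Longrightarrow> (x, y) \<in> mirrors T
    \<Longrightarrow> beam_arrives k T i (x + 1, y) Rightward"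

definition arriving_beam :: "nat \<Rightarrow> nat \<Rightarrow> edge set \<Rightarrow> direction \<Rightarrow> edge \<Rightarrow> nat" where
  "arriving_beam n k T d = (\<lambda>(u, v).
     THE i. i \<in> {1..n - 2 * k} \<and> beam_arrives k T i (int u, int v) d)"

definition oriented_dual :: "nat \<Rightarrow> nat \<Rightarrow> edge set \<Rightarrow> (nat, edge) pre_digraph" where
  "oriented_dual n k T =
     \<lparr>verts = {1..n - 2 * k},
      arcs = {e \<in> T. k_relevant n k e},
      tail = arriving_beam n k T Upward,
      head = arriving_beam n k T Rightward\<rparr>"

definition incidence_cone ::
    "(nat \<Rightarrow> 'm::finite) \<Rightarrow> (nat, 'b) pre_digraph \<Rightarrow> (real ^ 'm) set" where
  "incidence_cone ix G =
     convex_cone hull {axis (ix (tail G a)) 1 - axis (ix (head G a)) 1 | a. a \<in> arcs G}"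

definition cone_at :: "'a::real_vector set \<Rightarrow> 'a \<Rightarrow> 'a set" where
  "cone_at P p = {c *\<^sub>R (x - p) | c x. 0 \<le> c \<and> x \<in> P}"

end

(*
  Sweeping the lattice points column by column, the beams form a pseudoline arrangement on a sorting
  network: at each relevant point two neighbouring beams either touch (a mirror) or cross.

  Crossing-free sets are arrangements by the 0-1 principle. If the beams starting in the rows up to c
  are marked, then the maximal size of a crossing contained in a rectangle changes from a lattice point
  to the next according to the marks of the beams passing between them. Hence T has no (k+1)-crossing
  iff the network sorts the beams, and the k-triangulations are the arrangements in which every two
  beams cross exactly once.

  Flipping a contact moves the beam vector by a positive multiple of e_i - e_j, where i is the beam
  below and j the beam above; so the incidence cone lies in the cone at the vertex. Conversely let a
  functional f not decrease from the lower to the upper beam at any contact of T. Then f is maximal at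
  T: an arrangement maximising f has the same property, breaking ties by flips makes both arrangements
  compatible with one linear order of the beams, and there is at most one arrangement compatible with
  a given linear order. Indeed the latter is clear for the order in which the greedy arrangement is the
  only candidate, and exchanging two consecutive beams in the order changes the compatible
  arrangements by moving the crossing of these two beams between their first and their last meeting.
*)
theory Submission
  imports Defs
begin

section \<open>Arrangements on sorting networks\<close>

text \<open>Each beam coordinate equals, up to a constant depending only on the beam, the sum of the
  levels of the beam at the column ends. So linear functionals on beam vectors become weighted sums
  of levels of lines, and vertices can be compared in an abstract network without grid or stars. The
  multiple in a flip is strictly positive because two lines cannot meet twice without a column end
  in between.

  The obstacle is that the absence of an improving flip is a local condition, and that functionals
  may have ties. Uniqueness along a linear order replaces any global comparison: \<open>f\<close>
  serves to sort the beams, and then a local and a global maximum can both be moved, without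
  changing their weights, to the same arrangement.

  The missing inclusion follows by duality: the incidence cone is finitely generated, hence closed,
  so a difference of beam vectors outside it would be separated from it by a functional whose
  negative satisfies the condition at all contacts of \<open>T\<close> without being maximal
  there.\<close>

fun prec :: "nat list \<Rightarrow> nat \<Rightarrow> nat \<Rightarrow> bool" where
  "prec [] x y \<longleftrightarrow> False"
| "prec (z # zs) x y \<longleftrightarrow> (x = z \<and> y \<in> set zs) \<or> prec zs x y"

lemma prec_append:
  "prec (us @ vs) x y \<longleftrightarrow> prec us x y \<or> (x \<in> set us \<and> y \<in> set vs) \<or> prec vs x y"
  by (induction us) auto

lemma prec_in_set: "prec os x y \<Longrightarrow> x \<in> set os \<and> y \<in> set os"
  by (induction os) auto

text \<open>Turns a list into a weight that follows it, for use as the tie-breaking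
  functional.\<close>

lemma prec_rank:
  "distinct os \<Longrightarrow> \<exists>g :: nat \<Rightarrow> nat. \<forall>x\<in>set os. \<forall>y\<in>set os. prec os x y \<longleftrightarrow> g x < g y"
proof (induction os)
  case (Cons z zs)
  then obtain g :: "nat \<Rightarrow> nat" where g: "\<forall>x\<in>set zs. \<forall>y\<in>set zs. prec zs x y \<longleftrightarrow> g x < g y" by auto
  show ?case
    using Cons.prems g
    by (intro exI[of _ "\<lambda>x. if x = z then 0 else Suc (g x)"]) (auto dest: prec_in_set)
qed auto

text \<open>Under a flip of \<open>a\<close> and \<open>b\<close>, the lines at another contact keep
  their names or have \<open>a\<close> and \<open>b\<close> transposed. The two claims let the order
  with \<open>a\<close> and \<open>b\<close> exchanged accept such a contact in both cases.\<close>

lemma prec_swap: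
  assumes "distinct (us @ a # b # vs)" "x \<noteq> y"
  shows "{x, y} \<noteq> {a, b} \<Longrightarrow> prec (us @ b # a # vs) x y \<longleftrightarrow> prec (us @ a # b # vs) x y"
    and "prec (us @ a # b # vs) (Transposition.transpose a b x) (Transposition.transpose a b y)
      \<longleftrightarrow> prec (us @ b # a # vs) x y"
  using assms
  by (auto simp: prec_append Transposition.transpose_def doubleton_eq_iff dest: prec_in_set)

text \<open>The tail is rearranged behind the head \<open>x\<close>, which then moves right to its
  place. The step carries the multiset so that distinctness and the underlying set remain
  available.\<close>

lemma adjacent_swap_induct:
  assumes "mset xs = mset ys" "P xs"
    and "\<And>us a b vs. mset (us @ a # b # vs) = mset xs \<Longrightarrow> P (us @ a # b # vs) \<Longrightarrow> P (us @ b # a # vs)"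
  shows "P ys"
  using assms
proof (induction xs arbitrary: ys P)
  case (Cons x xs)
  then have "x \<in> set ys" by (metis list.set_intros(1) set_mset_mset)
  then obtain us vs where ys: "ys = us @ x # vs" by (meson split_list)
  have ms: "mset (x # us @ vs) = mset (x # xs)" using Cons.prems(1) ys by simp
  have "P (x # us @ vs)"
  proof (rule Cons.IH[where P = "\<lambda>z. P (x # z)"])
    show "P (x # us' @ b # a # vs')" if "mset (us' @ a # b # vs') = mset xs" "P (x # us' @ a # b # vs')"
      for us' a b vs'
      using Cons.prems(3)[of "x # us'" a b vs'] that by simp
  qed (use ms Cons.prems in auto)
  then have "P (take i us @ x # drop i us @ vs)" if "i \<le> length us" for i
    using that
  proof (induction i)
    case (Suc i)
    have 1: "drop i us = us ! i # drop (Suc i) us" using Suc.prems by (simp add: Cons_nth_drop_Suc)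
    have 2: "take (Suc i) us = take i us @ [us ! i]" using Suc.prems by (simp add: take_Suc_conv_app_nth)
    have "mset us = mset (take i us) + mset (drop i us)"
      by (metis append_take_drop_id mset_append)
    then have "mset (take i us @ x # us ! i # drop (Suc i) us @ vs) = mset (x # xs)"
      using ms unfolding 1 by (simp add: add.assoc)
    from Cons.prems(3)[OF this] Suc show ?case unfolding 1 2 by simp
  qed simp
  from this[of "length us"] show ?case using ys by simp
qed simp

lemma finite_has_maximizer:
  fixes h :: "'a \<Rightarrow> real"
  assumes "finite A" "A \<noteq> {}"
  shows "\<exists>x\<in>A. \<forall>y\<in>A. h y \<le> h x"
proof -
  obtain x where "x \<in> A" "h x = Max (h ` A)"
    using Max_in[of "h ` A"] assms by (metis (full_types) finite_imageI image_iff image_is_empty)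
  then have "\<forall>y\<in>A. h y \<le> h x" using assms(1) by simp
  then show ?thesis using \<open>x \<in> A\<close> by blast
qed

text \<open>
  At a time \<open>t \<in> E\<close> the two lines at the levels \<open>lev t\<close> and \<open>lev t + 1\<close> meet. A set \<open>X \<subseteq> E\<close>
  describes the arrangement in which they cross if \<open>t \<in> X\<close>, and only touch if \<open>t \<in> E - X\<close>. Lines
  are named after their initial levels, and \<open>state X t\<close> maps the levels to the lines at time \<open>t\<close>.
\<close>

locale sorting_network =
  fixes lev :: "nat \<Rightarrow> nat" and N :: nat and E :: "nat set" and lo hi :: nat
  assumes E_bound: "t \<in> E \<Longrightarrow> t < N"
    and lev_bound: "t \<in> E \<Longrightarrow> lo \<le> lev t \<and> Suc (lev t) < hi"
begin

primrec state :: "nat set \<Rightarrow> nat \<Rightarrow> nat \<Rightarrow> nat" where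
  "state X 0 = id"
| "state X (Suc t) =
     (if t \<in> X then state X t \<circ> Transposition.transpose (lev t) (Suc (lev t)) else state X t)"

primrec pos :: "nat set \<Rightarrow> nat \<Rightarrow> nat \<Rightarrow> nat" where
  "pos X 0 = id"
| "pos X (Suc t) =
     (if t \<in> X then Transposition.transpose (lev t) (Suc (lev t)) \<circ> pos X t else pos X t)"

definition lower :: "nat set \<Rightarrow> nat \<Rightarrow> nat" where
  "lower X t = state X t (lev t)"

definition upper :: "nat set \<Rightarrow> nat \<Rightarrow> nat" where
  "upper X t = state X t (Suc (lev t))"

definition touching :: "nat set \<Rightarrow> nat \<Rightarrow> nat set" where
  "touching X t = {lower X t, upper X t}"

definition reversed :: "nat set \<Rightarrow> bool" where
  "reversed X \<longleftrightarrow> (\<forall>d\<in>{lo..<hi}. state X N d = lo + hi - 1 - d)"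

text \<open>\<open>reversed\<close> alone forces every two lines to cross, so injectivity makes them
  cross exactly once. The levels at the times in \<open>X\<close> then spell a reduced word of the
  longest permutation.\<close>

definition reduced :: "nat set \<Rightarrow> bool" where
  "reduced X \<longleftrightarrow> X \<subseteq> E \<and> reversed X \<and> inj_on (touching X) X"

definition line_pairs :: "nat set set" where
  "line_pairs = {p. p \<subseteq> {lo..<hi} \<and> card p = 2}"

lemma finite_E [simp]: "finite E"
  using E_bound by (meson finite_nat_set_iff_bounded)

lemma pos_state [simp]: "pos X t (state X t d) = d"
  by (induction t arbitrary: d) auto

lemma state_pos [simp]: "state X t (pos X t a) = a"
  by (induction t arbitrary: a) auto

lemma state_eq_iff [simp]: "state X t d = state X t d' \<longleftrightarrow> d = d'"
  by (metis pos_state)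

lemma pos_eq_iff [simp]: "pos X t a = pos X t a' \<longleftrightarrow> a = a'"
  by (metis state_pos)

lemma pos_eq: "pos X t a = d \<longleftrightarrow> a = state X t d"
  by auto

lemma state_in_range:
  assumes "X \<subseteq> E" shows "state X t d \<in> {lo..<hi} \<longleftrightarrow> d \<in> {lo..<hi}"
proof (induction t arbitrary: d)
  case (Suc t)
  have "t \<in> X \<Longrightarrow> lo \<le> lev t \<and> Suc (lev t) < hi" using assms lev_bound by auto
  then have "Transposition.transpose (lev t) (Suc (lev t)) d \<in> {lo..<hi} \<longleftrightarrow> d \<in> {lo..<hi}" if "t \<in> X"
    using that by (auto simp: Transposition.transpose_def)
  then show ?case by (simp add: Suc del: atLeastLessThan_iff)
qed auto

lemma lower_neq_upper [simp]: "lower X t \<noteq> upper X t" "upper X t \<noteq> lower X t"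
  by (auto simp: lower_def upper_def)

lemma lower_upper_in_range:
  assumes "X \<subseteq> E" "t \<in> E"
  shows "lower X t \<in> {lo..<hi}" "upper X t \<in> {lo..<hi}"
  using assms lev_bound[of t] by (auto simp: lower_def upper_def state_in_range simp del: atLeastLessThan_iff) auto

lemma state_upto_cong: "(\<And>s. s < t \<Longrightarrow> s \<in> X \<longleftrightarrow> s \<in> Y) \<Longrightarrow> state X t = state Y t"
  by (induction t) auto

lemma state_unchanged:
  assumes "t \<le> t'" "\<And>s. t \<le> s \<Longrightarrow> s < t' \<Longrightarrow> s \<in> X \<Longrightarrow> lev s \<noteq> d \<and> Suc (lev s) \<noteq> d"
  shows "state X t' d = state X t d"
  using assms
proof (induction rule: dec_induct)
  case (step s)
  then show ?case by (auto simp: Transposition.transpose_def)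
qed auto

lemma pos_less_step:
  assumes "a \<noteq> b" "\<not> (t \<in> X \<and> touching X t = {a, b})"
  shows "pos X (Suc t) a < pos X (Suc t) b \<longleftrightarrow> pos X t a < pos X t b"
proof (cases "t \<in> X")
  case True
  have "\<not> (pos X t a = lev t \<and> pos X t b = Suc (lev t))"
    "\<not> (pos X t b = lev t \<and> pos X t a = Suc (lev t))"
    using assms True by (auto simp: touching_def lower_def upper_def pos_eq)
  moreover have "pos X t a \<noteq> pos X t b" using assms by simp
  ultimately show ?thesis using True
    by (auto simp: Transposition.transpose_def)
qed auto

lemma pos_less_interval:
  assumes "a \<noteq> b" "t \<le> t'" "\<And>s. t \<le> s \<Longrightarrow> s < t' \<Longrightarrow> s \<in> X \<Longrightarrow> touching X s \<noteq> {a, b}"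
  shows "pos X t' a < pos X t' b \<longleftrightarrow> pos X t a < pos X t b"
  using assms(2,3)
proof (induction rule: dec_induct)
  case (step s)
  then show ?case using pos_less_step[OF assms(1), of s X] by auto
qed auto

lemma pos_lower [simp]: "pos X t (lower X t) = lev t"
  by (simp add: lower_def)

lemma pos_upper [simp]: "pos X t (upper X t) = Suc (lev t)"
  by (simp add: upper_def)

lemma pos_less_touching:
  assumes "touching X t = {a, b}" "a \<noteq> b"
  shows "pos X t a < pos X t b \<longleftrightarrow> lower X t = a"
  using assms by (auto simp: touching_def doubleton_eq_iff)

section \<open>Reversing and reduced arrangements\<close>

lemma reversed_pos:
  assumes "X \<subseteq> E" "reversed X" "a \<in> {lo..<hi}"
  shows "pos X N a = lo + hi - 1 - a"
proof -
  have "lo + hi - 1 - a \<in> {lo..<hi}" using assms(3) by auto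
  then have "state X N (lo + hi - 1 - a) = lo + hi - 1 - (lo + hi - 1 - a)"
    using assms(2) by (auto simp: reversed_def)
  also have "\<dots> = a" using assms(3) by auto
  finally show ?thesis by (simp add: pos_eq)
qed

text \<open>The order of two lines is opposite at the times \<open>0\<close> and \<open>N\<close>,
  and only a crossing of these two lines can change it.\<close>

lemma reversed_crossing:
  assumes X: "X \<subseteq> E" "reversed X" and ab: "a \<in> {lo..<hi}" "b \<in> {lo..<hi}" "a \<noteq> b"
  shows "\<exists>t\<in>X. touching X t = {a, b}"
proof (rule ccontr)
  assume "\<not> ?thesis"
  then have "pos X N a < pos X N b \<longleftrightarrow> pos X 0 a < pos X 0 b"
    by (intro pos_less_interval) (use ab in auto)
  then show False using ab by (auto simp: reversed_pos[OF X])
qed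

lemma touching_image:
  assumes "X \<subseteq> E" "reversed X"
  shows "touching X ` X = line_pairs"
proof
  show "touching X ` X \<subseteq> line_pairs"
    using lower_upper_in_range[OF assms(1)] assms(1) by (force simp: touching_def line_pairs_def)
  show "line_pairs \<subseteq> touching X ` X"
  proof
    fix p assume "p \<in> line_pairs"
    then obtain a b where ab: "p = {a, b}" "a \<noteq> b" "a \<in> {lo..<hi}" "b \<in> {lo..<hi}"
      unfolding line_pairs_def card_2_iff by blast
    then show "p \<in> touching X ` X"
      using reversed_crossing[OF assms ab(3,4,2)] by blast
  qed
qed

lemma finite_reduced: "reduced X \<Longrightarrow> finite X"
  unfolding reduced_def using finite_subset[OF _ finite_E] by auto

text \<open>The crossing pairs always exhaust \<open>line_pairs\<close>, so crossing only once is a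
  matter of counting. Under a flip, only the size and the final state need to be followed.\<close>

lemma reduced_iff_card:
  assumes "X \<subseteq> E" "reversed X"
  shows "reduced X \<longleftrightarrow>
    card X = card line_pairs"
proof -
  have "finite X" using assms(1) finite_subset[OF _ finite_E] by auto
  then have "inj_on (touching X) X \<longleftrightarrow> card (touching X ` X) = card X"
    by (rule inj_on_iff_eq_card)
  moreover have "reduced X \<longleftrightarrow> inj_on (touching X) X"
    using assms by (simp add: reduced_def)
  ultimately show ?thesis
    by (simp add: touching_image[OF assms] eq_commute)
qed

lemma reduced_card_eq: "reduced X \<Longrightarrow> reduced Y \<Longrightarrow> card X = card Y"
  using reduced_iff_card[of X] reduced_iff_card[of Y] by (simp add: reduced_def)

lemma reduced_crossing:
  assumes "reduced X" "a \<in> {lo..<hi}" "b \<in> {lo..<hi}" "a \<noteq> b"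
  shows "\<exists>!t. t \<in> X \<and> touching X t = {a, b}"
  using assms reversed_crossing[of X a b] unfolding reduced_def inj_on_def by metis

lemma reduced_pos_less:
  assumes X: "reduced X" and e: "e \<in> X" "touching X e = {a, b}" "a < b"
  shows "pos X t a < pos X t b \<longleftrightarrow> t \<le> e"
proof -
  have XE: "X \<subseteq> E" and rev: "reversed X" using X by (auto simp: reduced_def)
  have "e \<in> E" using XE e(1) by auto
  then have ab: "a \<in> {lo..<hi}" "b \<in> {lo..<hi}"
    using lower_upper_in_range[OF XE, of e] e(2) by (auto simp: touching_def doubleton_eq_iff)
  have uniq: "s = e" if "s \<in> X" "touching X s = {a, b}" for s
    using X that e by (auto simp: reduced_def inj_on_def)
  show ?thesis
  proof (cases "t \<le> e")
    case True
    have "pos X t a < pos X t b \<longleftrightarrow> pos X 0 a < pos X 0 b"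
    proof (rule pos_less_interval)
      show "touching X s \<noteq> {a, b}" if "s < t" "s \<in> X" for s
        using that uniq[of s] True by auto
    qed (use e(3) in auto)
    then show ?thesis using True e(3) by simp
  next
    case False
    \<comment> \<open>\<open>t\<close> may exceed \<open>N\<close>. Nothing of \<open>X\<close> lies
      at or after \<open>N\<close>, and the crossing \<open>e\<close> is over at time
      \<open>t\<close>, so \<open>T\<close> links \<open>t\<close> with \<open>N\<close>.\<close>
    define T where "T = max t N"
    have *: "pos X T a < pos X T b \<longleftrightarrow> pos X N a < pos X N b"
    proof (rule pos_less_interval)
      show "touching X s \<noteq> {a, b}" if "N \<le> s" "s \<in> X" for s
        using that XE E_bound[of s] by auto
    qed (use e(3) in \<open>auto simp: T_def\<close>)
    have "pos X T a < pos X T b \<longleftrightarrow> pos X t a < pos X t b"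
    proof (rule pos_less_interval)
      show "touching X s \<noteq> {a, b}" if "t \<le> s" "s \<in> X" for s
        using that uniq[of s] False by auto
    qed (use e(3) in \<open>auto simp: T_def\<close>)
    with * show ?thesis using False e(3) ab by (auto simp: reversed_pos[OF XE rev])
  qed
qed

lemma reduced_lower_less_upper:
  assumes "reduced X" "t \<in> X" shows "lower X t < upper X t"
proof (rule ccontr)
  assume "\<not> ?thesis"
  then have "upper X t < lower X t" by (metis lower_neq_upper(1) linorder_neqE_nat)
  then have "pos X t (upper X t) < pos X t (lower X t)"
    using reduced_pos_less[OF assms, of "upper X t" "lower X t" t] by (auto simp: touching_def)
  then show False by simp
qed

text \<open>If every crossing has the smaller name below, a pair once out of order is never put
  back, so no pair crosses twice.\<close>

lemma increasing_imp_reduced: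
  assumes "X \<subseteq> E" "reversed X" and inc: "\<And>t. t \<in> X \<Longrightarrow> lower X t < upper X t"
  shows "reduced X"
proof -
  have mono: "pos X t' b < pos X t' a" if "pos X t b < pos X t a" "t \<le> t'" "a < b" for a b t t'
    using that(2,1)
  proof (induction rule: dec_induct)
    case (step s)
    have "\<not> (s \<in> X \<and> touching X s = {b, a})"
      using step inc[of s] that(3) pos_less_touching[of X s b a]
      by (auto simp: touching_def doubleton_eq_iff)
    then show ?case using step pos_less_step[of b a s X] that(3) by auto
  qed
  have False if t: "t \<in> X" "t' \<in> X" "touching X t = touching X t'" "t < t'" for t t'
  proof -
    let ?a = "lower X t" and ?b = "upper X t"
    have "pos X (Suc t) ?b < pos X (Suc t) ?a" using t(1) by simp
    then have "pos X t' ?b < pos X t' ?a"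
      using mono[of "Suc t" ?b ?a t'] inc[OF t(1)] t(4) by (simp del: pos.simps)
    moreover have "pos X t' ?a < pos X t' ?b"
      using t(3) inc[OF t(1)] inc[OF t(2)] by (auto simp: touching_def doubleton_eq_iff)
    ultimately show False by simp
  qed
  then have "inj_on (touching X) X"
    by (metis inj_onI linorder_neqE_nat)
  then show ?thesis using assms by (simp add: reduced_def)
qed

text \<open>Membership of \<open>t\<close> depends on the state before \<open>t\<close>, hence on
  the earlier members. So the states \<open>S\<close> are built by recursion without naming the set,
  which is then read off from them.\<close>

lemma greedy_exists:
  assumes "A \<subseteq> E"
  shows "\<exists>X\<subseteq>A. \<forall>t\<in>A. t \<in> X \<longleftrightarrow> lower X t < upper X t"
proof -
  define S :: "nat \<Rightarrow> nat \<Rightarrow> nat" where "S = rec_nat id (\<lambda>t s.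
    if t \<in> A \<and> s (lev t) < s (Suc (lev t))
    then s \<circ> Transposition.transpose (lev t) (Suc (lev t)) else s)"
  have S: "S 0 = id" "\<And>t. S (Suc t) = (if t \<in> A \<and> S t (lev t) < S t (Suc (lev t))
    then S t \<circ> Transposition.transpose (lev t) (Suc (lev t)) else S t)"
    by (simp_all add: S_def)
  define X where "X = {t\<in>A. S t (lev t) < S t (Suc (lev t))}"
  have mem: "t \<in> X \<longleftrightarrow> t \<in> A \<and> S t (lev t) < S t (Suc (lev t))" for t
    by (simp add: X_def)
  have "state X t = S t" for t
    by (induction t) (simp_all only: S state.simps mem)
  then show ?thesis by (intro exI[of _ X]) (auto simp: mem lower_def upper_def)
qed

text \<open>
  Exchanging the roles of a contact and of the crossing of the same two lines only exchanges the
  names of these two lines between the two places.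
\<close>

lemma state_flip:
  fixes X e e'
  defines "X' \<equiv> insert e (X - {e'})"
  assumes e: "e \<notin> X" and e': "e' \<in> X" and touch: "touching X e = {a, b}" "touching X e' = {a, b}"
  shows "state X' t = (if min e e' < t \<and> t \<le> max e e'
    then Transposition.transpose a b \<circ> state X t else state X t)"
proof (induction t)
  case (Suc t)
  have "e \<noteq> e'" using e e' by auto
  have *: "state X s \<circ> Transposition.transpose (lev s) (Suc (lev s)) =
      Transposition.transpose a b \<circ> state X s" if "touching X s = {a, b}" for s
    using that by (auto simp: fun_eq_iff Transposition.transpose_def touching_def lower_def
        upper_def doubleton_eq_iff)
  consider "t = e" | "t = e'" | "t \<noteq> e" "t \<noteq> e'" by blast
  then show ?case
  proof cases
    case 1
    have "state X' e = (if e' < e then Transposition.transpose a b \<circ> state X e else state X e)"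
      using Suc \<open>e \<noteq> e'\<close> 1 by auto
    moreover have "e \<in> X'" by (simp add: X'_def)
    ultimately have "state X' (Suc e) = (if e' < e then Transposition.transpose a b \<circ>
      (Transposition.transpose a b \<circ> state X e) else Transposition.transpose a b \<circ> state X e)"
      using *[OF touch(1)] by (simp add: comp_assoc)
    then show ?thesis using 1 e \<open>e \<noteq> e'\<close> by (auto simp: fun_eq_iff)
  next
    case 2
    have "state X' e' = (if e < e' then Transposition.transpose a b \<circ> state X e' else state X e')"
      using Suc \<open>e \<noteq> e'\<close> 2 by auto
    moreover have "e' \<notin> X'" using \<open>e \<noteq> e'\<close> by (simp add: X'_def)
    ultimately show ?thesis using *[OF touch(2)] 2 e' \<open>e \<noteq> e'\<close>
      by (auto simp: fun_eq_iff)
  next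
    case 3
    then have "t \<in> X' \<longleftrightarrow> t \<in> X" by (auto simp: X'_def)
    then show ?thesis using Suc 3 by (auto simp: comp_assoc)
  qed
qed auto

lemma pos_flip:
  fixes X e e'
  defines "X' \<equiv> insert e (X - {e'})"
  assumes e: "e \<notin> X" and e': "e' \<in> X" and touch: "touching X e = {a, b}" "touching X e' = {a, b}"
  shows "pos X' t c = pos X t (if min e e' < t \<and> t \<le> max e e'
    then Transposition.transpose a b c else c)"
  using state_flip[OF e e' touch, folded X'_def, of t]
  by (auto simp: pos_eq)

lemma touching_flip:
  fixes X e e'
  defines "X' \<equiv> insert e (X - {e'})"
  assumes e: "e \<notin> X" and e': "e' \<in> X" and touch: "touching X e = {a, b}" "touching X e' = {a, b}"
  shows "touching X' t = {a, b} \<longleftrightarrow> touching X t = {a, b}"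
proof -
  have "touching X' t = (if min e e' < t \<and> t \<le> max e e'
    then Transposition.transpose a b ` touching X t else touching X t)"
    using state_flip[OF e e' touch, folded X'_def, of t]
    by (auto simp: touching_def lower_def upper_def)
  moreover have "Transposition.transpose a b ` {a, b} = {a, b}" by auto
  ultimately show ?thesis
    by (metis inj_image_eq_iff inj_transpose)
qed

text \<open>After both meetings the names are back in place, so the final state is unchanged, and so
  is the size.\<close>

lemma reduced_flip:
  assumes X: "reduced X" and e: "e \<in> E - X" and e': "e' \<in> X"
    and touch: "touching X e = {a, b}" "touching X e' = {a, b}"
  shows "reduced (insert e (X - {e'}))"
proof -
  let ?X' = "insert e (X - {e'})"
  have XE: "X \<subseteq> E" "reversed X" using X by (auto simp: reduced_def)
  have "e < N" "e' < N" using E_bound XE e e' by auto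
  then have "state ?X' N = state X N"
    using state_flip[of e X e' a b N] e e' touch by auto
  then have "reversed ?X'" using XE by (simp add: reversed_def)
  moreover have "?X' \<subseteq> E" using XE e by auto
  moreover have "card ?X' = card X"
  proof -
    have "card ?X' = Suc (card (X - {e'}))" using e finite_reduced[OF X] by simp
    then show ?thesis using card_Suc_Diff1[OF finite_reduced[OF X] e'] by simp
  qed
  ultimately show ?thesis using X XE by (simp add: reduced_iff_card)
qed

lemma reduced_flip_exists:
  assumes X: "reduced X" and e: "e \<in> E - X"
  obtains e' where "e' \<in> X" "touching X e' = touching X e"
proof -
  have "X \<subseteq> E" using X by (auto simp: reduced_def)
  then show ?thesis
    using that reduced_crossing[OF X, of "lower X e" "upper X e"] lower_upper_in_range[of X e] e
    by (auto simp: touching_def)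
qed

section \<open>Arrangements compatible with a linear order of the lines\<close>

definition compatible :: "nat list \<Rightarrow> nat set \<Rightarrow> bool" where
  "compatible os X \<longleftrightarrow> reduced X \<and> (\<forall>t\<in>E - X. prec os (lower X t) (upper X t))"

definition touch_times :: "nat set \<Rightarrow> nat \<Rightarrow> nat \<Rightarrow> nat set" where
  "touch_times X a b = {t \<in> E. touching X t = {a, b}}"

lemma finite_touch_times [simp]: "finite (touch_times X a b)"
  by (simp add: touch_times_def)

text \<open>
  In an arrangement whose contacts between \<open>a\<close> and \<open>b\<close> all have \<open>a\<close> below, the crossing of
  \<open>a\<close> and \<open>b\<close> is their first or last meeting.
\<close>

definition extreme_meeting :: "nat set \<Rightarrow> nat \<Rightarrow> nat \<Rightarrow> nat" where
  "extreme_meeting X a b = (if b < a then Min (touch_times X a b) else Max (touch_times X a b))"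

text \<open>\<open>state X t\<close> is taken before time \<open>t\<close> acts, so the crossing
  time \<open>e'\<close> itself still shows the initial order; hence \<open>\<le>\<close> in one
  case and \<open><\<close> in the other.\<close>

lemma lower_at_meeting:
  assumes X: "reduced X" and e': "e' \<in> X" "touching X e' = {a, b}" and ab: "a \<noteq> b"
    and t: "touching X t = {a, b}"
  shows "lower X t = a \<longleftrightarrow> (if a < b then t \<le> e' else e' < t)"
proof (cases "a < b")
  case True
  then show ?thesis
    using reduced_pos_less[OF X e'(1,2) True, of t] pos_less_touching[OF t ab] by auto
next
  case False
  then have "b < a" using ab by auto
  have "touching X e' = {b, a}" "touching X t = {b, a}" using e' t by auto
  from reduced_pos_less[OF X e'(1) this(1) \<open>b < a\<close>, of t] pos_less_touching[OF this(2)] ab t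
  show ?thesis using False by (auto simp: touching_def doubleton_eq_iff)
qed

lemma meeting_crossing:
  assumes X: "reduced X" and a: "a \<in> {lo..<hi}" and b: "b \<in> {lo..<hi}" and ab: "a \<noteq> b"
    and below: "\<And>t. t \<in> touch_times X a b - X \<Longrightarrow> lower X t = a"
  shows "extreme_meeting X a b \<in> X" "extreme_meeting X a b \<in> touch_times X a b"
    "\<And>t. t \<in> touch_times X a b \<Longrightarrow> t \<in> X \<Longrightarrow> t = extreme_meeting X a b"
proof -
  have XE: "X \<subseteq> E" using X by (simp add: reduced_def)
  obtain e' where e': "e' \<in> X" "touching X e' = {a, b}"
    using reduced_crossing[OF X a b ab] by blast
  have K: "e' \<in> touch_times X a b" using e' XE by (auto simp: touch_times_def)
  have uniq: "t = e'" if "t \<in> touch_times X a b" "t \<in> X" for t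
    using that e' X by (auto simp: touch_times_def reduced_def inj_on_def)
  \<comment> \<open>A contact with \<open>a\<close> below comes before the crossing if
    \<open>a < b\<close>, and after it otherwise.\<close>
  have "if a < b then t \<le> e' else e' \<le> t" if "t \<in> touch_times X a b" for t
  proof (cases "t = e'")
    case False
    then have "lower X t = a" using below uniq that by blast
    then show ?thesis
      using lower_at_meeting[OF X e' ab, of t] that by (auto simp: touch_times_def split: if_splits)
  qed auto
  then have fm: "extreme_meeting X a b = e'"
    using K ab by (auto simp: extreme_meeting_def intro!: Min_eqI Max_eqI)
  show "extreme_meeting X a b \<in> X" "extreme_meeting X a b \<in> touch_times X a b"
    "\<And>t. t \<in> touch_times X a b \<Longrightarrow> t \<in> X \<Longrightarrow> t = extreme_meeting X a b"
    unfolding fm by (fact e'(1), fact K, erule (1) uniq)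
qed

text \<open>As \<open>a\<close> and \<open>b\<close> are neighbours in the order, their exchange
  affects no other comparison, and the flip renames only these two lines. Since
  \<open>touch_times\<close> is preserved, the same construction with \<open>a\<close> and
  \<open>b\<close> exchanged leads back to \<open>X\<close>; this makes uniqueness
  transferable.\<close>

lemma compatible_swap:
  assumes os: "distinct (us @ a # b # vs)" "set (us @ a # b # vs) = {lo..<hi}"
    and X: "compatible (us @ a # b # vs) X"
  defines "Y \<equiv> insert (extreme_meeting X b a) (X - {extreme_meeting X a b})"
  shows "compatible (us @ b # a # vs) Y" "touch_times Y a b = touch_times X a b"
    "X = insert (extreme_meeting Y a b) (Y - {extreme_meeting Y b a})"
proof -
  let ?e' = "extreme_meeting X a b" and ?e = "extreme_meeting X b a"
  have ab: "a \<in> {lo..<hi}" "b \<in> {lo..<hi}" "a \<noteq> b" using os by auto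
  have red: "reduced X" and XE: "X \<subseteq> E" using X by (auto simp: compatible_def reduced_def)
  have below: "lower X t = a" if "t \<in> touch_times X a b - X" for t
  proof -
    have "prec (us @ a # b # vs) (lower X t) (upper X t)"
      using that X by (auto simp: compatible_def touch_times_def)
    moreover have "touching X t = {a, b}" using that by (simp add: touch_times_def)
    ultimately show ?thesis using os(1)
      by (auto simp: touching_def doubleton_eq_iff prec_append dest: prec_in_set)
  qed
  have e': "?e' \<in> X" "?e' \<in> touch_times X a b"
    "\<And>t. t \<in> touch_times X a b \<Longrightarrow> t \<in> X \<Longrightarrow> t = ?e'"
    using meeting_crossing[OF red ab] below by blast+
  have comm: "touch_times Z b a = touch_times Z a b" for Z by (simp add: touch_times_def insert_commute)
  have eK: "?e \<in> touch_times X a b"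
    using e'(2) ab by (auto simp: extreme_meeting_def comm intro!: Min_in Max_in)
  have touch: "touching X ?e = {a, b}" "touching X ?e' = {a, b}"
    using e'(2) eK by (auto simp: touch_times_def)
  have main: "compatible (us @ b # a # vs) Y \<and> touch_times Y a b = touch_times X a b"
  proof (cases "?e = ?e'")
    \<comment> \<open>The first and the last meeting coincide, so \<open>a\<close> and
      \<open>b\<close> have no contact.\<close>
    case True
    then have "Y = X" using e'(1) by (auto simp: Y_def)
    moreover have "touching X t \<noteq> {a, b}" if "t \<in> E - X" for t
    proof
      assume "touching X t = {a, b}"
      then have "t \<in> touch_times X a b" using that by (auto simp: touch_times_def)
      then have "Min (touch_times X a b) \<le> t \<and> t \<le> Max (touch_times X a b)" by simp
      then have "t = ?e'" using True ab(3) by (auto simp: extreme_meeting_def comm split: if_splits)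
      then show False using that e'(1) by auto
    qed
    ultimately show ?thesis using X prec_swap(1)[OF os(1)]
      by (auto simp: compatible_def touching_def)
  next
    case False
    then have eX: "?e \<notin> X" using e'(3)[OF eK] by auto
    have eE: "?e \<in> E" using eK by (simp add: touch_times_def)
    have redY: "reduced Y" unfolding Y_def
      using reduced_flip[OF red _ e'(1) touch] eX eE by auto
    have KY: "touch_times Y a b = touch_times X a b"
      using touching_flip[OF eX e'(1) touch] by (simp add: touch_times_def Y_def)
    have "prec (us @ b # a # vs) (lower Y t) (upper Y t)" if t: "t \<in> E - Y" for t
    proof (cases "touching Y t = {a, b}")
      \<comment> \<open>In \<open>Y\<close> the two lines cross at the opposite extreme meeting, so
        each of their contacts has \<open>b\<close> below.\<close>
      case True
      then have "t \<in> touch_times X a b" using t KY by (auto simp: touch_times_def)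
      then have "Min (touch_times X a b) \<le> t \<and> t \<le> Max (touch_times X a b)" by simp
      moreover have "t \<noteq> ?e" using t by (auto simp: Y_def)
      moreover have "?e \<in> Y" by (simp add: Y_def)
      moreover have "touching Y ?e = {a, b}" using eK KY by (auto simp: touch_times_def)
      ultimately have "lower Y t \<noteq> a"
        using lower_at_meeting[OF redY, of ?e a b t] True ab(3)
        by (auto simp: extreme_meeting_def comm split: if_splits)
      then have "lower Y t = b" "upper Y t = a"
        using True by (auto simp: touching_def doubleton_eq_iff)
      then show ?thesis by (simp add: prec_append)
    next
      case False
      have tX: "t \<in> E - X" using t False touch(2) touching_flip[OF eX e'(1) touch, of t]
        by (auto simp: Y_def)
      then have p: "prec (us @ a # b # vs) (lower X t) (upper X t)" using X by (simp add: compatible_def)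
      have st: "state Y t = (if min ?e ?e' < t \<and> t \<le> max ?e ?e'
          then Transposition.transpose a b \<circ> state X t else state X t)"
        unfolding Y_def by (rule state_flip[OF eX e'(1) touch])
      have "touching X t \<noteq> {a, b}"
        using False touching_flip[OF eX e'(1) touch, of t] by (simp add: Y_def)
      then have "prec (us @ b # a # vs) (lower X t) (upper X t)"
        using p prec_swap(1)[OF os(1), of "lower X t" "upper X t"] by (simp add: touching_def)
      moreover have "prec (us @ b # a # vs) (Transposition.transpose a b (lower X t))
          (Transposition.transpose a b (upper X t))"
        using p prec_swap(2)[of us b a vs "lower X t" "upper X t"] os(1)
        by (auto simp: transpose_commute)
      ultimately show ?thesis using st by (auto simp: lower_def upper_def)
    qed
    then show ?thesis using redY KY by (simp add: compatible_def)
  qed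
  then show "compatible (us @ b # a # vs) Y" "touch_times Y a b = touch_times X a b" by auto
  then have "extreme_meeting Y a b = ?e'" "extreme_meeting Y b a = ?e"
    by (simp_all add: extreme_meeting_def comm)
  then show "X = insert (extreme_meeting Y a b) (Y - {extreme_meeting Y b a})"
    using e'(1) e'(3)[OF eK] unfolding Y_def by auto
qed

lemma compatible_unique:
  assumes "distinct os" "set os = {lo..<hi}" "compatible os X" "compatible os Y"
  shows "X = Y"
proof -
  define P where "P = (\<lambda>os. \<forall>X Y. compatible os X \<longrightarrow> compatible os Y \<longrightarrow> X = Y)"
  \<comment> \<open>In the decreasing order a contact has the larger name below, while a crossing of
    a reduced arrangement has the smaller one below. So the state before \<open>t\<close> decides
    whether \<open>t\<close> is a crossing.\<close>
  have base: "P (rev [lo..<hi])" unfolding P_def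
  proof (intro allI impI)
    fix X Y assume XY: "compatible (rev [lo..<hi]) X" "compatible (rev [lo..<hi]) Y"
    have prec_rev: "y < x" if "prec (rev [lo..<hi]) x y" for x y
      using that by (induction hi) (auto simp: prec_append split: if_splits)
    have greedy: "t \<in> Z \<longleftrightarrow> lower Z t < upper Z t" if "compatible (rev [lo..<hi]) Z" "t \<in> E" for Z t
      using that prec_rev[of "lower Z t" "upper Z t"] reduced_lower_less_upper[of Z t]
      unfolding compatible_def by (metis DiffI order.asym)
    have "t \<in> X \<longleftrightarrow> t \<in> Y" for t
    proof (induction t rule: less_induct)
      case (less t)
      then have "state X t = state Y t" by (rule state_upto_cong)
      then have "t \<in> E \<Longrightarrow> t \<in> X \<longleftrightarrow> t \<in> Y"
        using greedy[OF XY(1)] greedy[OF XY(2)] by (simp add: lower_def upper_def)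
      then show ?case using XY by (auto simp: compatible_def reduced_def)
    qed
    then show "X = Y" by auto
  qed
  have "P os"
  proof (rule adjacent_swap_induct[where P = P, OF _ base])
    show "mset (rev [lo..<hi]) = mset os"
      using assms(1,2) by (metis atLeastLessThan_upt distinct_upt mset_rev set_eq_iff_mset_eq_distinct)
    fix us a b vs
    assume ms: "mset (us @ a # b # vs) = mset (rev [lo..<hi])" and P: "P (us @ a # b # vs)"
    have os: "distinct (us @ b # a # vs)" "set (us @ b # a # vs) = {lo..<hi}"
    proof -
      have "distinct (us @ a # b # vs)" using ms by (metis distinct_rev distinct_upt mset_eq_imp_distinct_iff)
      moreover have "set (us @ a # b # vs) = {lo..<hi}"
        using mset_eq_setD[OF ms] by simp
      ultimately show "distinct (us @ b # a # vs)" "set (us @ b # a # vs) = {lo..<hi}" by auto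
    qed
    show "P (us @ b # a # vs)" unfolding P_def
    proof (intro allI impI)
      fix X Y assume X: "compatible (us @ b # a # vs) X" and Y: "compatible (us @ b # a # vs) Y"
      note X' = compatible_swap[OF os X] and Y' = compatible_swap[OF os Y]
      have "insert (extreme_meeting X a b) (X - {extreme_meeting X b a}) =
          insert (extreme_meeting Y a b) (Y - {extreme_meeting Y b a})"
        using P X'(1) Y'(1) unfolding P_def by blast
      then show "X = Y" using X'(3) Y'(3) by metis
    qed
  qed
  then show ?thesis using assms by (auto simp: P_def)
qed

end

section \<open>Areas under the lines and weights of arrangements\<close>

locale sampled_network = sorting_network +
  fixes samp :: "nat set"
  assumes finite_samp: "finite samp"
    and samp_between: "\<lbrakk>t \<in> E; t' \<in> E; t < t'; \<forall>s\<in>samp. \<not> (t < s \<and> s \<le> t')\<rbrakk> \<Longrightarrow> lev t < lev t'"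
begin

text \<open>The discrete area under the line \<open>c\<close>; on the polygon it is the beam
  coordinate up to a constant.\<close>

definition area :: "nat set \<Rightarrow> nat \<Rightarrow> real" where
  "area X c = (\<Sum>t\<in>samp. real (pos X t c))"

text \<open>Until the next sample the network acts only on levels above \<open>lev t\<close>, so the
  line left at level \<open>lev t\<close> by time \<open>t\<close> stays there and cannot take part
  at \<open>t'\<close>. A sample at \<open>t'\<close> itself counts, as it is taken before
  \<open>t'\<close> acts.\<close>

lemma sample_between_meetings:
  assumes XE: "X \<subseteq> E" and t: "t \<in> E" "t' \<in> E" "t < t'" "touching X t = touching X t'"
  shows "\<exists>s\<in>samp. t < s \<and> s \<le> t'"
proof (rule ccontr)
  assume no: "\<not> ?thesis"
  define c where "c = state X (Suc t) (lev t)"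
  have lev: "lev t < lev s" if "t < s" "s \<le> t'" "s \<in> E" for s
    using samp_between[of t s] that t no by (meson le_trans)
  have "state X t' (lev t) = c" unfolding c_def
  proof (rule state_unchanged)
    show "lev s \<noteq> lev t \<and> Suc (lev s) \<noteq> lev t" if "Suc t \<le> s" "s < t'" "s \<in> X" for s
      using lev[of s] that XE by auto
  qed (use t in simp)
  then have pos: "pos X t' c = lev t" by (simp add: pos_eq)
  have "c \<in> touching X t"
    by (auto simp: c_def touching_def lower_def upper_def)
  then have "pos X t' c \<ge> lev t'" unfolding t(4) by (auto simp: touching_def)
  then show False using pos lev[of t'] t by auto
qed

text \<open>The two lines exchange their positions exactly at the samples between \<open>e\<close>
  and \<open>e'\<close>. There they are in the same order as at \<open>e\<close>, so all gaps summed
  in \<open>\<delta>\<close> are positive, and there is at least one such sample.\<close>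

lemma area_flip:
  assumes X: "reduced X" and e: "e \<in> E - X" and e': "e' \<in> X" "touching X e' = touching X e"
  obtains \<delta> where "\<delta> > 0"
    "\<And>c. area (insert e (X - {e'})) c - area X c =
      (if c = lower X e then \<delta> else if c = upper X e then - \<delta> else 0)"
proof -
  let ?X' = "insert e (X - {e'})" and ?a = "lower X e" and ?b = "upper X e"
  have XE: "X \<subseteq> E" using X by (simp add: reduced_def)
  have touch: "touching X e = {?a, ?b}" "touching X e' = {?a, ?b}"
    using e' by (auto simp: touching_def)
  define S where "S = {t \<in> samp. min e e' < t \<and> t \<le> max e e'}"
  define \<delta> where "\<delta> = (\<Sum>t\<in>S. real (pos X t ?b) - real (pos X t ?a))"
  have "finite S" using finite_samp by (simp add: S_def)
  have "e \<noteq> e'" using e e' by auto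
  have pos': "pos ?X' t c = pos X t (if min e e' < t \<and> t \<le> max e e'
    then Transposition.transpose ?a ?b c else c)" for t c
    using pos_flip[of e X e' ?a ?b t c] e e' touch by auto
  have less: "pos X t ?a < pos X t ?b" if "t \<in> S" for t
  proof -
    have t: "min e e' < t" "t \<le> max e e'" using that by (auto simp: S_def)
    have "touching X s \<noteq> {?a, ?b}" if "s \<in> X" "s \<noteq> e'" for s
      using that X e' touch by (auto simp: reduced_def inj_on_def)
    moreover have "e \<notin> X" using e by simp
    ultimately have "pos X t ?a < pos X t ?b \<longleftrightarrow> pos X e ?a < pos X e ?b"
      using pos_less_interval[of ?a ?b e t X] pos_less_interval[of ?a ?b t e X] t
      by (cases "e < e'") (force simp: min_def max_def split: if_splits)+
    then show ?thesis by simp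
  qed
  have "S \<noteq> {}"
  proof (cases "e < e'")
    case True
    then show ?thesis using sample_between_meetings[OF XE, of e e'] e e' XE by (auto simp: S_def)
  next
    case False
    then have "e' < e" using \<open>e \<noteq> e'\<close> by auto
    then show ?thesis using sample_between_meetings[OF XE, of e' e] e e' XE by (auto simp: S_def)
  qed
  then have "\<delta> > 0" unfolding \<delta>_def
    using \<open>finite S\<close> less by (intro sum_pos) auto
  moreover have "area ?X' c - area X c =
      (if c = ?a then \<delta> else if c = ?b then - \<delta> else 0)" for c
  proof -
    have "area ?X' c - area X c = (\<Sum>t\<in>samp. real (pos ?X' t c) - real (pos X t c))"
      by (simp add: area_def sum_subtractf)
    also have "\<dots> = (\<Sum>t\<in>S. real (pos ?X' t c) - real (pos X t c))"
      by (rule sum.mono_neutral_right) (use finite_samp pos' in \<open>auto simp: S_def\<close>)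
    also have "\<dots> = (\<Sum>t\<in>S. real (pos X t (Transposition.transpose ?a ?b c)) - real (pos X t c))"
      by (rule sum.cong) (auto simp: S_def pos')
    also have "\<dots> = (if c = ?a then \<delta> else if c = ?b then - \<delta> else 0)"
      by (auto simp: \<delta>_def sum_negf[symmetric])
    finally show ?thesis .
  qed
  ultimately show ?thesis using that by blast
qed

definition weight :: "(nat \<Rightarrow> real) \<Rightarrow> nat set \<Rightarrow> real" where
  "weight f X = (\<Sum>c\<in>{lo..<hi}. f c * area X c)"

text \<open>One flip serves all weights, so it can be tested with \<open>f\<close> and with a
  tie-breaking weight. If \<open>f\<close> agrees on the two lines, renaming them changes no value
  of \<open>f\<close>, so the condition at the contacts survives.\<close>

lemma weight_flip:
  assumes X: "reduced X" and e: "e \<in> E - X"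
  obtains X' \<delta> where "reduced X'" "\<delta> > 0"
    "\<And>f. weight f X' = weight f X + \<delta> * (f (lower X e) - f (upper X e))"
    "\<And>f. f (lower X e) = f (upper X e) \<Longrightarrow> (\<forall>t\<in>E - X. f (lower X t) \<le> f (upper X t)) \<Longrightarrow>
      (\<forall>t\<in>E - X'. (f (lower X' t) :: real) \<le> f (upper X' t))"
proof -
  have XE: "X \<subseteq> E" using X by (simp add: reduced_def)
  obtain e' where e': "e' \<in> X" "touching X e' = touching X e"
    using reduced_flip_exists[OF X e] by blast
  have touch: "touching X e = {lower X e, upper X e}" "touching X e' = {lower X e, upper X e}"
    using e' by (auto simp: touching_def)
  define X' where "X' = insert e (X - {e'})"
  obtain \<delta> where \<delta>: "\<delta> > 0" "\<And>c. area X' c - area X c =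
      (if c = lower X e then \<delta> else if c = upper X e then - \<delta> else 0)"
    using area_flip[OF X e e'] unfolding X'_def by blast
  have "reduced X'" unfolding X'_def using reduced_flip[OF X e e'(1)] touch by auto
  moreover have "weight f X' = weight f X + \<delta> * (f (lower X e) - f (upper X e))" for f
  proof -
    have I: "lower X e \<in> {lo..<hi}" "upper X e \<in> {lo..<hi}"
      using lower_upper_in_range[OF XE] e by auto
    have "weight f X' - weight f X = (\<Sum>c\<in>{lo..<hi}. f c * (area X' c - area X c))"
      by (simp add: weight_def sum_subtractf[symmetric] right_diff_distrib)
    also have "\<dots> = (\<Sum>c\<in>{lo..<hi}. (if c = lower X e then f c * \<delta> else 0) -
        (if c = upper X e then f c * \<delta> else 0))"
      by (rule sum.cong) (auto simp: \<delta>(2))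
    also have "\<dots> = \<delta> * (f (lower X e) - f (upper X e))"
      using I by (simp add: sum_subtractf right_diff_distrib mult.commute)
    finally show ?thesis by simp
  qed
  moreover have "f (lower X' t) \<le> f (upper X' t)"
    if f: "f (lower X e) = f (upper X e)" "\<forall>t\<in>E - X. f (lower X t) \<le> f (upper X t)"
      and t: "t \<in> E - X'" for f :: "nat \<Rightarrow> real" and t
  proof -
    have "e \<notin> X" using e by simp
    note st = state_flip[OF this e'(1) touch, of t, folded X'_def]
    have *: "f (Transposition.transpose (lower X e) (upper X e) c) = f c" for c
      using f(1) by (simp add: Transposition.transpose_def)
    have **: "f (state X' t d) = f (state X t d)" for d
      using st * by auto
    show ?thesis
    proof (cases "t = e'")
      case True
      then show ?thesis using touch(2) f(1) **
        by (auto simp: lower_def upper_def touching_def doubleton_eq_iff)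
    next
      case False
      then show ?thesis using f(2) t ** by (auto simp: X'_def lower_def upper_def)
    qed
  qed
  ultimately show ?thesis using \<delta>(1) that by blast
qed

lemma finite_reduced_sets: "finite {X. reduced X \<and> P X}"
  by (rule finite_subset[of _ "Pow E"]) (auto simp: reduced_def)

text \<open>Ties of \<open>f\<close> are broken by maximising a second weight, which follows the list.\<close>

lemma compatible_refinement:
  assumes X: "reduced X" "\<forall>t\<in>E - X. f (lower X t) \<le> f (upper X t)"
    and os: "distinct os" "set os = {lo..<hi}" "\<And>x y. prec os x y \<Longrightarrow> f x \<le> f y"
  shows "\<exists>Y. compatible os Y \<and> weight f Y = weight f X"
proof -
  obtain g :: "nat \<Rightarrow> nat" where g: "\<forall>x\<in>{lo..<hi}. \<forall>y\<in>{lo..<hi}. prec os x y \<longleftrightarrow> g x < g y"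
    using prec_rank[OF os(1)] os(2) by auto
  have inj: "prec os x y \<or> prec os y x" if "x \<in> set os" "y \<in> set os" "x \<noteq> y" for x y
    using that by (induction os) auto
  define A where "A = {Y. reduced Y \<and> (\<forall>t\<in>E - Y. f (lower Y t) \<le> f (upper Y t)) \<and> weight f Y = weight f X}"
  have "finite A" unfolding A_def by (rule finite_reduced_sets)
  moreover have "X \<in> A" using X by (simp add: A_def)
  ultimately obtain Y where Y: "Y \<in> A" "\<forall>Z\<in>A. weight (\<lambda>c. real (g c)) Z \<le> weight (\<lambda>c. real (g c)) Y"
    using finite_has_maximizer[of A "weight (\<lambda>c. real (g c))"] by blast
  have red: "reduced Y" "Y \<subseteq> E" using Y(1) by (auto simp: A_def reduced_def)
  have "prec os (lower Y t) (upper Y t)" if t: "t \<in> E - Y" for t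
  proof (rule ccontr)
    assume "\<not> ?thesis"
    moreover have I: "lower Y t \<in> {lo..<hi}" "upper Y t \<in> {lo..<hi}"
      using lower_upper_in_range[OF red(2)] t by auto
    ultimately have prec: "prec os (upper Y t) (lower Y t)"
      using inj[of "lower Y t" "upper Y t"] os(2) by auto
    \<comment> \<open>A contact against the list is a tie of \<open>f\<close>; flipping it stays in
      \<open>A\<close> but raises the second weight.\<close>
    then have "f (lower Y t) = f (upper Y t)" using os(3) Y(1) t by (force simp: A_def)
    moreover obtain Z \<delta> where Z: "reduced Z" "\<delta> > 0"
      "\<And>f. weight f Z = weight f Y + \<delta> * (f (lower Y t) - f (upper Y t))"
      "f (lower Y t) = f (upper Y t) \<Longrightarrow> (\<forall>t\<in>E - Y. f (lower Y t) \<le> f (upper Y t)) \<Longrightarrow>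
        (\<forall>t\<in>E - Z. f (lower Z t) \<le> f (upper Z t))"
      using weight_flip[OF red(1) t] by metis
    ultimately have "Z \<in> A" using Y(1) by (auto simp: A_def)
    then have "\<delta> * (real (g (lower Y t)) - real (g (upper Y t))) \<le> 0" using Y(2) Z(3) by force
    moreover have "g (upper Y t) < g (lower Y t)" using prec g I by auto
    ultimately show False using Z(2) by (simp add: mult_le_0_iff)
  qed
  then show ?thesis using Y(1) red by (auto simp: compatible_def A_def)
qed

theorem weight_maximal:
  assumes X: "reduced X" "\<forall>t\<in>E - X. f (lower X t) \<le> f (upper X t)" and Y: "reduced Y"
  shows "weight f Y \<le> weight f X"
proof -
  define A where "A = {Y. reduced Y}"
  have "finite A" "X \<in> A" "Y \<in> A" using finite_reduced_sets[of "\<lambda>_. True"] X Y by (auto simp: A_def)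
  then obtain J where J: "J \<in> A" "\<forall>Z\<in>A. weight f Z \<le> weight f J"
    using finite_has_maximizer[of A "weight f"] by blast
  have "f (lower J t) \<le> f (upper J t)" if t: "t \<in> E - J" for t
  proof (rule ccontr)
    assume "\<not> ?thesis"
    moreover have "reduced J" using J(1) by (simp add: A_def)
    then obtain Z \<delta> where Z: "reduced Z" "\<delta> > 0"
      "weight f Z = weight f J + \<delta> * (f (lower J t) - f (upper J t))"
      using weight_flip[OF _ t] by metis
    moreover have "weight f Z \<le> weight f J" using J(2) Z(1) by (simp add: A_def)
    ultimately show False by (simp add: mult_le_0_iff)
  qed
  \<comment> \<open>A list sorted by \<open>f\<close> is admissible for the refinement of both
    \<open>X\<close> and \<open>J\<close>.\<close>
  moreover define os where "os = sort_key f [lo..<hi]"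
  have os: "distinct os" "set os = {lo..<hi}" by (auto simp: os_def)
  have "sorted (map f os)" by (simp add: os_def)
  then have "f x \<le> f y" if "prec os x y" for x y
    using that by (induction os) auto
  ultimately obtain X' J' where "compatible os X'" "weight f X' = weight f X"
    "compatible os J'" "weight f J' = weight f J"
    using compatible_refinement[OF X os] compatible_refinement[of J f, OF _ _ os] J(1) unfolding A_def by blast
  then have "weight f X = weight f J" using compatible_unique[OF os] by metis
  then show ?thesis using J(2) \<open>Y \<in> A\<close> by simp
qed

end

section \<open>Crossings\<close>

text \<open>
  \<open>chain_len F c x z\<close> is the maximal size of a crossing of edges \<open>(u, v) \<in> F\<close> with \<open>u < x\<close> and
  \<open>c < v < z\<close>, provided that \<open>x \<le> c + 1\<close>.
\<close>

fun chain_len :: "edge set \<Rightarrow> nat \<Rightarrow> nat \<Rightarrow> nat \<Rightarrow> nat" where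
  "chain_len F c 0 z = 0"
| "chain_len F c (Suc x) 0 = 0"
| "chain_len F c (Suc x) (Suc z) = (if z \<le> c then 0
     else max (max (chain_len F c x (Suc z)) (chain_len F c (Suc x) z))
       (chain_len F c x z + (if (x, z) \<in> F then 1 else 0)))"

lemma chain_len_row_0 [simp]: "z \<le> Suc c \<Longrightarrow> chain_len F c x z = 0"
  by (cases x; cases z) auto

lemma chain_len_mono_col: "chain_len F c x z \<le> chain_len F c (Suc x) z"
  by (cases z) (auto simp del: chain_len.simps(1))

lemma chain_len_mono_row: "chain_len F c x z \<le> chain_len F c x (Suc z)"
  by (cases x) auto

lemma chain_len_col_step: "chain_len F c (Suc x) z \<le> Suc (chain_len F c x z)"
proof (induction z)
  case (Suc z)
  then show ?case using chain_len_mono_row[of F c x z] by auto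
qed simp

lemma chain_len_row_step: "chain_len F c x (Suc z) \<le> Suc (chain_len F c x z)"
proof (induction x)
  case (Suc x)
  then show ?case using chain_len_mono_col[of F c x z] by auto
qed simp

lemma chain_len_le_cols: "chain_len F c x z \<le> x"
proof (induction x)
  case (Suc x)
  then show ?case using chain_len_col_step[of F c x z] by simp
qed simp

lemma chain_len_le_rows: "chain_len F c x z \<le> z - Suc c"
proof (induction z)
  case (Suc z)
  then show ?case using chain_len_row_step[of F c x z] by (cases "z \<le> c") auto
qed (cases x; simp)

lemma chain_len_upper:
  assumes "finite S" "S \<subseteq> F" "pairwise crosses S" "x \<le> Suc c"
    and "\<And>u v. (u, v) \<in> S \<Longrightarrow> u < x \<and> c < v \<and> v < z"
  shows "card S \<le> chain_len F c x z"
  using assms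
proof (induction F c x z arbitrary: S rule: chain_len.induct)
  case (1 F c z)
  then have "S = {}" by auto
  then show ?case by simp
next
  case (2 F c x)
  then have "S = {}" by auto
  then show ?case by simp
next
  case (3 F c x z)
  have cmp: "(a < a' \<and> b < b') \<or> (a' < a \<and> b' < b)"
    if "(a, b) \<in> S" "(a', b') \<in> S" "(a, b) \<noteq> (a', b')" for a b a' b'
    using 3(6) that by (force simp: pairwise_def)
  show ?case
  proof (cases "z \<le> c")
    case True
    then have "S = {}" using 3(8) by fastforce
    then show ?thesis by simp
  next
    case z: False
    have "(x, z) \<in> S" if "(x, v) \<in> S" "(u, z) \<in> S" for u v
    proof (rule ccontr)
      assume "(x, z) \<notin> S"
      then have "(u, z) \<noteq> (x, v)" using that by auto
      then show False using cmp[OF that(2,1)] "3.prems"(5)[OF that(1)] "3.prems"(5)[OF that(2)] by auto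
    qed
    then consider "(x, z) \<in> S" | "\<And>v. (x, v) \<notin> S" | "\<And>u. (u, z) \<notin> S" by blast
    then show ?thesis
    proof cases
      case 1
      have "card (S - {(x, z)}) \<le> chain_len F c x z"
      proof (rule "3.IH"(3)[OF z])
        fix u v assume "(u, v) \<in> S - {(x, z)}"
        then show "u < x \<and> c < v \<and> v < z" using cmp[of u v x z] 3(8)[of u v] 1 by auto
      qed (use 3 in \<open>auto simp: pairwise_def\<close>)
      moreover have "card S = Suc (card (S - {(x, z)}))" using 1 3(4) by (metis card_Suc_Diff1)
      moreover have "(x, z) \<in> F" using 1 3(5) by auto
      ultimately show ?thesis using z by auto
    next
      case 2
      have "card S \<le> chain_len F c x (Suc z)"
      proof (rule "3.IH"(1)[OF z])
        fix u v assume "(u, v) \<in> S"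
        then show "u < x \<and> c < v \<and> v < Suc z" using 3(8)[of u v] 2[of v] by (metis less_Suc_eq)
      qed (use 3 in auto)
      then show ?thesis using z by auto
    next
      case 3
      have "card S \<le> chain_len F c (Suc x) z"
      proof (rule "3.IH"(2)[OF z])
        fix u v assume "(u, v) \<in> S"
        then show "u < Suc x \<and> c < v \<and> v < z" using "3.prems"(5)[of u v] 3[of u] by (metis less_Suc_eq)
      qed (use "3.prems" in auto)
      then show ?thesis using z by auto
    qed
  qed
qed

lemma chain_len_attained:
  assumes "x \<le> Suc c"
  shows "\<exists>S\<subseteq>F. finite S \<and> pairwise crosses S \<and> card S = chain_len F c x z \<and>
    (\<forall>(u, v)\<in>S. u < x \<and> c < v \<and> v < z)"
  using assms
proof (induction F c x z rule: chain_len.induct)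
  case (3 F c x z)
  show ?case
  proof (cases "z \<le> c")
    case True
    then show ?thesis by (intro exI[of _ "{}"]) auto
  next
    case z: False
    have "chain_len F c (Suc x) (Suc z) = max (max (chain_len F c x (Suc z)) (chain_len F c (Suc x) z))
       (chain_len F c x z + (if (x, z) \<in> F then 1 else 0))"
      using z by simp
    then have "chain_len F c (Suc x) (Suc z) = chain_len F c x (Suc z) \<or>
        chain_len F c (Suc x) (Suc z) = chain_len F c (Suc x) z \<or>
        chain_len F c (Suc x) (Suc z) = Suc (chain_len F c x z) \<and> (x, z) \<in> F"
      using chain_len_mono_row[of F c x z] by (simp add: max_def del: chain_len.simps)
    then consider "chain_len F c (Suc x) (Suc z) = chain_len F c x (Suc z)"
      | "chain_len F c (Suc x) (Suc z) = chain_len F c (Suc x) z"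
      | "chain_len F c (Suc x) (Suc z) = Suc (chain_len F c x z)" "(x, z) \<in> F"
      by blast
    then show ?thesis
    proof cases
      case 1
      obtain S where "S \<subseteq> F" "finite S" "pairwise crosses S" "card S = chain_len F c x (Suc z)"
        "\<forall>(u, v)\<in>S. u < x \<and> c < v \<and> v < Suc z"
        using "3.IH"(1)[OF z] "3.prems" by auto
      then show ?thesis using 1 by (intro exI[of _ S]) (auto simp del: chain_len.simps)
    next
      case 2
      obtain S where "S \<subseteq> F" "finite S" "pairwise crosses S" "card S = chain_len F c (Suc x) z"
        "\<forall>(u, v)\<in>S. u < Suc x \<and> c < v \<and> v < z"
        using "3.IH"(2)[OF z] "3.prems" by blast
      then show ?thesis using 2 by (intro exI[of _ S]) (auto simp del: chain_len.simps)
    next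
      case 3
      obtain S where S: "S \<subseteq> F" "finite S" "pairwise crosses S" "card S = chain_len F c x z"
        "\<forall>(u, v)\<in>S. u < x \<and> c < v \<and> v < z"
        using "3.IH"(3)[OF z] "3.prems" by auto
      have "(x, z) \<notin> S" using S(5) by auto
      \<comment> \<open>The bound on the column gives \<open>u < x \<le> c < v < z\<close> for every
        edge \<open>(u, v)\<close> of \<open>S\<close>.\<close>
      moreover have "crosses e (x, z) \<and> crosses (x, z) e" if "e \<in> S" for e
        using that S(5) "3.prems" by (cases e) fastforce
      ultimately show ?thesis using S 3 z
        by (intro exI[of _ "insert (x, z) S"]) (auto simp: pairwise_insert simp del: chain_len.simps)
    qed
  qed
qed (auto intro: exI[of _ "{}"])

lemma crossing_free_iff_chain_len:
  assumes F: "F \<subseteq> polygon_edges n"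
  shows "crossing_free (Suc k) F \<longleftrightarrow> (\<forall>c. chain_len F c (Suc c) n \<le> k)"
proof
  assume free: "crossing_free (Suc k) F"
  show "\<forall>c. chain_len F c (Suc c) n \<le> k"
  proof (rule ccontr, clarsimp simp: not_le simp del: chain_len.simps)
    fix c assume "k < chain_len F c (Suc c) n"
    moreover obtain S where S: "S \<subseteq> F" "finite S" "pairwise crosses S" "card S = chain_len F c (Suc c) n"
      using chain_len_attained[of "Suc c" c F n] by auto
    ultimately obtain S' where "S' \<subseteq> S" "card S' = Suc k" "finite S'"
      using obtain_subset_with_card_n[of "Suc k" S] by (metis Suc_leI)
    then show False using free S unfolding crossing_free_def crossing_def
      by (meson order_trans pairwise_subset)
  qed
next
  assume le: "\<forall>c. chain_len F c (Suc c) n \<le> k"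
  show "crossing_free (Suc k) F" unfolding crossing_free_def
  proof (rule notI, clarify)
    fix S assume S: "S \<subseteq> F" "crossing (Suc k) S"
    then have fin: "finite S" "card S = Suc k" "pairwise crosses S" by (auto simp: crossing_def)
    then have ne: "S \<noteq> {}" by auto
    \<comment> \<open>All edges of a crossing pass over its largest left endpoint, so
      \<open>chain_len\<close> with this \<open>c\<close> counts all of them.\<close>
    define c where "c = Max (fst ` S)"
    have c: "u \<le> c" if "(u, v) \<in> S" for u v
      unfolding c_def using that fin(1) by (intro Max_ge) force+
    have "c \<in> fst ` S" unfolding c_def using fin(1) ne by (intro Max_in) auto
    then obtain d where d: "(c, d) \<in> S" by auto
    have "c < d" using d S(1) F by (auto simp: polygon_edges_def)
    have "card S \<le> chain_len F c (Suc c) n"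
    proof (rule chain_len_upper[OF fin(1) S(1) fin(3)])
      fix u v assume uv: "(u, v) \<in> S"
      have "v < n" using uv S(1) F by (auto simp: polygon_edges_def)
      moreover have "c < v"
      proof (cases "(u, v) = (c, d)")
        case False
        then have "crosses (u, v) (c, d)" using fin(3) uv d unfolding pairwise_def by blast
        then show ?thesis using c[OF uv] by auto
      qed (use \<open>c < d\<close> in simp)
      ultimately show "u < Suc c \<and> c < v \<and> v < n" using c[OF uv] by auto
    qed simp
    moreover have "chain_len F c (Suc c) n \<le> k" using le by blast
    ultimately show False using fin(2) by linarith
  qed
qed

lemma not_crossing_free:
  assumes "\<And>i. i \<le> k \<Longrightarrow> (a i, b i) \<in> T" "\<And>i j. i < j \<Longrightarrow> j \<le> k \<Longrightarrow> a i < a j \<and> b i < b j"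
    and "a k < b 0"
  shows "\<not> crossing_free (k + 1) T"
proof -
  let ?e = "\<lambda>i. (a i, b i)"
  have cr: "crosses (?e i) (?e j) \<and> crosses (?e j) (?e i)" if "i < j" "j \<le> k" for i j
  proof -
    have "a j \<le> a k" "b 0 \<le> b i" using assms(2)[of j k] assms(2)[of 0 i] that
      by (cases "j = k"; cases "i = 0"; force)+
    then show ?thesis using assms(2)[OF that] assms(3) by auto
  qed
  have inj: "inj_on ?e {..k}"
  proof (rule inj_onI)
    fix i j assume "i \<in> {..k}" "j \<in> {..k}" "?e i = ?e j"
    then show "i = j" using assms(2)[of i j] assms(2)[of j i] by (cases i j rule: linorder_cases) auto
  qed
  have "pairwise crosses (?e ` {..k})" unfolding pairwise_def
  proof (intro ballI impI)
    fix x y assume "x \<in> ?e ` {..k}" "y \<in> ?e ` {..k}" "x \<noteq> y"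
    then obtain i j where ij: "i \<le> k" "j \<le> k" "x = ?e i" "y = ?e j" by auto
    then have "i \<noteq> j" using \<open>x \<noteq> y\<close> by auto
    then consider "i < j" | "j < i" by linarith
    then show "crosses x y" by cases (use cr ij in blast)+
  qed
  then have "crossing (k + 1) (?e ` {..k})" using card_image[OF inj] by (simp add: crossing_def)
  moreover have "?e ` {..k} \<subseteq> T" using assms(1) by auto
  ultimately show ?thesis unfolding crossing_free_def by blast
qed

text \<open>Without the cyclic index the edges form a staircase, alternating between the two kinds
  as \<open>j\<close> grows; this is the order in which a beam meets its mirrors. An index
  \<open>j > k\<close> wraps around to \<open>j - k - 1\<close>.\<close>

lemma star_edges_eq:
  assumes "length s = 2 * k + 1" "sorted_wrt (<) s"
  shows "star_edges k s =
    {(s ! j, s ! (k + j)) | j. j \<le> k} \<union> {(s ! j, s ! (k + j + 1)) | j. j < k}" (is "_ = ?A \<union> ?B")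
proof -
  have le: "s ! i \<le> s ! j" if "i \<le> j" "j < 2 * k + 1" for i j
    using sorted_wrt_nth_less[OF assms(2), of i j] that assms(1) by (cases "i = j") auto
  have e1: "edge_between (s ! j) (s ! ((j + k) mod (2 * k + 1))) = (s ! j, s ! (k + j))" if "j \<le> k" for j
    using that le[of j "k + j"] by (auto simp: edge_between_def min_def max_def add.commute)
  have e2: "edge_between (s ! (k + j + 1)) (s ! ((k + j + 1 + k) mod (2 * k + 1))) = (s ! j, s ! (k + j + 1))"
    if "j < k" for j
  proof -
    have "(k + j + 1 + k) mod (2 * k + 1) = (j + (2 * k + 1)) mod (2 * k + 1)"
      by (rule arg_cong[where f = "\<lambda>x. x mod (2 * k + 1)"]) simp
    also have "\<dots> = j" using that by (simp del: add_Suc_right)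
    finally show ?thesis using that le[of j "k + j + 1"] by (auto simp: edge_between_def min_def max_def)
  qed
  show ?thesis
  proof
    show "star_edges k s \<subseteq> ?A \<union> ?B"
    proof
      fix e assume "e \<in> star_edges k s"
      then obtain j where j: "j < 2 * k + 1" "e = edge_between (s ! j) (s ! ((j + k) mod (2 * k + 1)))"
        by (auto simp: star_edges_def)
      show "e \<in> ?A \<union> ?B"
      proof (cases "j \<le> k")
        case True
        then show ?thesis using e1 j by auto
      next
        case False
        then have "j = k + (j - k - 1) + 1" "j - k - 1 < k" using j by auto
        then show ?thesis using e2[of "j - k - 1"] j(2) by auto
      qed
    qed
    show "?A \<union> ?B \<subseteq> star_edges k s"
    proof
      fix e assume "e \<in> ?A \<union> ?B"
      then consider j where "j \<le> k" "e = (s ! j, s ! (k + j))"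
        | j where "j < k" "e = (s ! j, s ! (k + j + 1))" by blast
      then show "e \<in> star_edges k s"
      proof cases
        case (1 j)
        then have "e = edge_between (s ! j) (s ! ((j + k) mod (2 * k + 1)))" using e1 by simp
        then show ?thesis using 1 unfolding star_edges_def by (intro CollectI exI[of _ j]) simp
      next
        case (2 j)
        then have "e = edge_between (s ! (k + j + 1)) (s ! ((k + j + 1 + k) mod (2 * k + 1)))"
          using e2 by simp
        then show ?thesis using 2 unfolding star_edges_def by (intro CollectI exI[of _ "k + j + 1"]) simp
      qed
    qed
  qed
qed

section \<open>The network of the polygon\<close>

locale polygon =
  fixes n k :: nat
  assumes k_pos: "k \<ge> 1" and n_large: "n \<ge> 2 * k + 1"
begin

text \<open>
  The lattice points are swept column by column, from bottom to top: the point \<open>(x, y)\<close> is reached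
  at time \<open>x * n + y\<close>. On the strip of relevant points, a beam going rightward to \<open>(x, y)\<close> or upward
  from it has level \<open>y - x\<close>, and a beam going upward to \<open>(x, y)\<close> or rightward from it has level
  \<open>y - x - 1\<close>. Beams are named after the row in which they start.
\<close>

definition level :: "nat \<Rightarrow> nat" where
  "level t = t mod n - t div n - 1"

definition relevant_times :: "nat set" where
  "relevant_times = {x * n + y | x y. y < n \<and> x + k < y \<and> y + k < x + n}"

definition column_ends :: "nat set" where
  "column_ends = (\<lambda>u. Suc u * n) ` {..<n}"

lemma time_less:
  assumes "y < n" "y' < n"
  shows "x * n + y < x' * n + y' \<longleftrightarrow> x < x' \<or> (x = x' \<and> y < y')"
proof -
  have *: "x1 * n + y1 < x2 * n + y2" if "x1 < x2" "y1 < n" for x1 x2 y1 y2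
  proof -
    have "Suc x1 * n \<le> x2 * n" using that(1) by (intro mult_le_mono1) simp
    then show ?thesis using that(2) by simp
  qed
  show ?thesis
  proof (cases x x' rule: linorder_cases)
    case greater
    then show ?thesis using *[of x' x y' y] assms by auto
  qed (use * assms in auto)
qed

lemma time_eq [simp]:
  assumes "y < n" "y' < n"
  shows "x * n + y = x' * n + y' \<longleftrightarrow> x = x' \<and> y = y'"
  using time_less[OF assms, of x x'] time_less[OF assms(2,1), of x' x] by auto

lemma relevant_timesE:
  assumes "t \<in> relevant_times"
  obtains x y where "t = x * n + y" "y < n" "x + k < y" "y + k < x + n" "level t = y - Suc x"
  using assms that by (fastforce simp: relevant_times_def level_def)

lemma time_in_relevant [simp]:
  assumes "y < n"
  shows "x * n + y \<in> relevant_times \<longleftrightarrow> x + k < y \<and> y + k < x + n"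
  using assms by (auto simp: relevant_times_def)

text \<open>Both levels at a relevant point lie in \<open>{k..<n - k}\<close>, which is also the
  range of the starting rows, so there are \<open>n - 2 * k\<close> lines, one for each star. Within
  a column the level rises with \<open>y\<close>, as sampling at the column ends requires.\<close>

sublocale sampled_network level "n * n" relevant_times k "n - k" column_ends
proof
  fix t assume "t \<in> relevant_times"
  then obtain x y where t: "t = x * n + y" "y < n" "x + k < y" "y + k < x + n" "level t = y - Suc x"
    by (rule relevant_timesE)
  have "Suc x * n \<le> n * n" using t by (intro mult_le_mono1) simp
  then show "t < n * n" using t by simp
  show "k \<le> level t \<and> Suc (level t) < n - k" using t by auto
next
  show "finite column_ends" by (simp add: column_ends_def)
next
  fix t t' assume A: "t \<in> relevant_times" "t' \<in> relevant_times" "t < t'"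
    "\<forall>s\<in>column_ends. \<not> (t < s \<and> s \<le> t')"
  obtain x y where t: "t = x * n + y" "y < n" "x + k < y" "y + k < x + n" "level t = y - Suc x"
    using A(1) by (rule relevant_timesE)
  obtain x' y' where t': "t' = x' * n + y'" "y' < n" "x' + k < y'" "y' + k < x' + n"
    "level t' = y' - Suc x'"
    using A(2) by (rule relevant_timesE)
  have "\<not> x < x'"
  proof
    assume "x < x'"
    then have "Suc x * n \<le> x' * n" by (intro mult_le_mono1) simp
    then have "t < Suc x * n \<and> Suc x * n \<le> t'" using t t' by simp
    moreover have "Suc x * n \<in> column_ends" using t by (auto simp: column_ends_def)
    ultimately show False using A(4) by blast
  qed
  then have "x = x'" "y < y'" using A(3) t t' by (auto simp: time_less)
  then show "level t < level t'" using t t' by auto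
qed

text \<open>\<open>hor\<close> and \<open>ver\<close> are the lines expected to arrive rightward and
  upward at \<open>(x, y)\<close>. That they are the actual beams is shown by
  \<open>beam_arrives_complete\<close> and \<open>beam_arrives_sound\<close>.\<close>

definition hor :: "nat set \<Rightarrow> nat \<Rightarrow> nat \<Rightarrow> nat" where
  "hor X x y = state X (x * n + y) (y - x)"

definition ver :: "nat set \<Rightarrow> nat \<Rightarrow> nat \<Rightarrow> nat" where
  "ver X x y = state X (x * n + y) (y - Suc x)"

lemma state_between_cells:
  assumes X: "X \<subseteq> relevant_times" and le: "t \<le> t'"
    and *: "\<And>x y. \<lbrakk>y < n; x + k < y; y + k < x + n; t \<le> x * n + y; x * n + y < t'\<rbrakk>
      \<Longrightarrow> y - x \<noteq> d \<and> y - Suc x \<noteq> d"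
  shows "state X t' d = state X t d"
proof (rule state_unchanged[OF le])
  fix s assume s: "t \<le> s" "s < t'" "s \<in> X"
  then obtain x y where "s = x * n + y" "y < n" "x + k < y" "y + k < x + n" "level s = y - Suc x"
    using X by (blast elim: relevant_timesE)
  then show "level s \<noteq> d \<and> Suc (level s) \<noteq> d" using *[of y x] s by auto
qed

context
  fixes X :: "nat set"
  assumes X: "X \<subseteq> relevant_times"
begin

lemma hor_0:
  assumes "y < n" shows "hor X 0 y = y"
proof -
  have "state X y y = state X 0 y"
  proof (rule state_between_cells[OF X])
    fix x' y' assume "y' < n" "x' * n + y' < y"
    then show "y' - x' \<noteq> y \<and> y' - Suc x' \<noteq> y" by auto
  qed simp
  then show ?thesis by (simp add: hor_def)
qed

lemma time_in_X: "y < n \<Longrightarrow> x * n + y \<in> X \<Longrightarrow> x + k < y \<and> y + k < x + n"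
  using X by fastforce

lemma level_time: "y < n \<Longrightarrow> level (x * n + y) = y - Suc x"
  by (simp add: level_def)

lemma lower_time: "y < n \<Longrightarrow> lower X (x * n + y) = ver X x y"
  by (simp add: lower_def ver_def level_time)

lemma upper_time: "y < n \<Longrightarrow> x < y \<Longrightarrow> upper X (x * n + y) = hor X x y"
  by (simp add: upper_def hor_def level_time Suc_diff_Suc)

text \<open>Between the two sweep times come only points above row \<open>y\<close> in column
  \<open>x\<close> and below row \<open>y\<close> in column \<open>Suc x\<close>. They act on levels
  above and below \<open>y - Suc x\<close>, respectively.\<close>

lemma hor_Suc:
  assumes "y < n" "x + k < y"
  shows "hor X (Suc x) y = (if x * n + y \<in> X then hor X x y else ver X x y)"
proof -
  have "state X (Suc x * n + y) (y - Suc x) = state X (Suc (x * n + y)) (y - Suc x)"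
  proof (rule state_between_cells[OF X])
    fix x' y' assume A: "y' < n" "x' + k < y'" "Suc (x * n + y) \<le> x' * n + y'" "x' * n + y' < Suc x * n + y"
    then have "x * n + y < x' * n + y'" by simp
    then have "x < x' \<or> (x = x' \<and> y < y')" "x' < Suc x \<or> (x' = Suc x \<and> y' < y)"
      using A(1,4) assms(1) time_less[of y y' x x'] time_less[of y' y x' "Suc x"] by auto
    then have "(x' = x \<and> y < y') \<or> (x' = Suc x \<and> y' < y)" by auto
    then show "y' - x' \<noteq> y - Suc x \<and> y' - Suc x' \<noteq> y - Suc x" using A(2) assms by auto
  qed (use k_pos n_large in simp)
  also have "\<dots> = (if x * n + y \<in> X then hor X x y else ver X x y)"
    using assms by (auto simp: level_time hor_def ver_def Suc_diff_Suc)
  finally show ?thesis by (simp add: hor_def)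
qed

lemma ver_Suc:
  assumes "y < n" "x + k \<le> y"
  shows "ver X x (Suc y) = (if x * n + y \<in> X then ver X x y else hor X x y)"
  using assms time_in_X[of y x] by (auto simp: level_time hor_def ver_def Suc_diff_Suc)

end

text \<open>
  Induction along the beams: \<open>PH x y\<close> speaks of the beam arriving rightward at \<open>(x, y)\<close> and \<open>PV x y\<close>
  of the beam arriving upward. On the points with \<open>y - x = k\<close> or \<open>y - x = n - k\<close>, which bound the
  strip of relevant points, only one of the two beams matters.
\<close>

lemma beam_induct:
  assumes start: "\<And>y. k \<le> y \<Longrightarrow> y + k < n \<Longrightarrow> PH 0 y"
    and right: "\<And>x y. \<lbrakk>y < n; x + k < y; y + k \<le> x + n; PV x y; y + k < x + n \<Longrightarrow> PH x y\<rbrakk>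
      \<Longrightarrow> PH (Suc x) y"
    and up: "\<And>x y. \<lbrakk>y < n; x + k \<le> y; y + k < x + n; PH x y; x + k < y \<Longrightarrow> PV x y\<rbrakk>
      \<Longrightarrow> PV x (Suc y)"
  shows "(x + k \<le> y \<and> y + k < x + n \<and> y < n \<longrightarrow> PH x y) \<and>
    (x + k < y \<and> y + k \<le> x + n \<and> y \<le> n \<longrightarrow> PV x y)"
proof (induction "x + y" arbitrary: x y rule: less_induct)
  case less
  have "PH x y" if H: "x + k \<le> y" "y + k < x + n" "y < n"
  proof (cases x)
    case 0
    then show ?thesis using start H by simp
  next
    case (Suc x')
    then show ?thesis using right[of y x'] less[of x' y] H by simp
  qed
  moreover have "PV x y" if V: "x + k < y" "y + k \<le> x + n" "y \<le> n"
  proof (cases y)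
    case (Suc y')
    then show ?thesis using up[of y' x] less[of x y'] V by simp
  qed (use V in simp)
  ultimately show ?case by blast
qed

text \<open>Beams never descend, and a beam arriving upward comes from the row below, hence the
  strict bound.\<close>

lemma beam_row_bound:
  assumes "X \<subseteq> relevant_times"
  shows "(x + k \<le> y \<and> y + k < x + n \<and> y < n \<longrightarrow> hor X x y \<le> y) \<and>
    (x + k < y \<and> y + k \<le> x + n \<and> y \<le> n \<longrightarrow> ver X x y < y)"
proof (rule beam_induct)
  fix x y assume "y < n" "x + k < y" "ver X x y < y" "y + k < x + n \<Longrightarrow> hor X x y \<le> y"
  then show "hor X (Suc x) y \<le> y"
    using time_in_X[OF assms, of y x] by (auto simp: hor_Suc[OF assms])
next
  fix x y assume "y < n" "x + k \<le> y" "hor X x y \<le> y" "x + k < y \<Longrightarrow> ver X x y < y"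
  then show "ver X x (Suc y) < Suc y"
    using time_in_X[OF assms, of y x] by (auto simp: ver_Suc[OF assms])
qed (auto simp: hor_0[OF assms])

definition irrelevant_edges :: "edge set" where
  "irrelevant_edges = {(u, v). u < v \<and> v < n \<and> (v \<le> u + k \<or> u + n \<le> v + k)}"

text \<open>The edges of \<open>F\<close> are forced contacts; at other relevant points beams cross
  whenever they meet in increasing order. This covers both a reduced arrangement with its own edges
  and the extension of a crossing-free \<open>F\<close>.\<close>

definition greedy_for :: "edge set \<Rightarrow> nat set \<Rightarrow> bool" where
  "greedy_for F X \<longleftrightarrow> X \<subseteq> relevant_times \<and>
     (\<forall>x y. y < n \<and> x + k < y \<and> y + k < x + n \<longrightarrow>
       (x * n + y \<in> X \<longleftrightarrow> (x, y) \<notin> F \<and> ver X x y < hor X x y))"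

lemma hor_neq_ver: "x < y \<Longrightarrow> hor X x y \<noteq> ver X x y"
  by (simp add: hor_def ver_def)

text \<open>The edges in this corner are irrelevant, so the diagonal ending at
  \<open>(x - 1, z - 1)\<close> is a crossing with one edge in each of the \<open>x\<close>
  columns.\<close>

lemma chain_len_corner:
  assumes F: "irrelevant_edges \<subseteq> F" and c: "c + k < n"
  shows "x + n \<le> z + k \<Longrightarrow> z \<le> n \<Longrightarrow> chain_len F c x z = x"
proof (induction x arbitrary: z)
  case (Suc x)
  then obtain z' where z': "z = Suc z'" using n_large by (cases z) auto
  have "(x, z') \<in> irrelevant_edges" using Suc.prems z' n_large by (auto simp: irrelevant_edges_def)
  then have "(x, z') \<in> F" "\<not> z' \<le> c" "chain_len F c x z' = x"
    using F Suc z' c by auto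
  then show ?case using chain_len_le_cols[of F c "Suc x" z] z' by auto
qed simp

text \<open>
  The 0-1 principle: mark the beams that start in the rows up to \<open>c\<close>. The increments of \<open>chain_len\<close>
  between neighbouring lattice points obey the same local rules as the marks.
\<close>

lemma beam_marks:
  assumes F: "irrelevant_edges \<subseteq> F" and X: "greedy_for F X" and c: "c + k < n"
  shows "(x + k \<le> y \<and> y + k < x + n \<and> y < n \<longrightarrow> x \<le> c \<longrightarrow> c < y \<longrightarrow>
      (hor X x y \<le> c \<longleftrightarrow> chain_len F c x (Suc y) = Suc (chain_len F c x y))) \<and>
    (x + k < y \<and> y + k \<le> x + n \<and> y \<le> n \<longrightarrow> x \<le> c \<longrightarrow> c < y \<longrightarrow>
      (ver X x y \<le> c \<longleftrightarrow> chain_len F c (Suc x) y = chain_len F c x y))"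
proof (rule beam_induct)
  have XE: "X \<subseteq> relevant_times" using X by (simp add: greedy_for_def)
  note step = chain_len_mono_row chain_len_mono_col chain_len_row_step chain_len_col_step
  show "0 \<le> c \<longrightarrow> c < y \<longrightarrow> (hor X 0 y \<le> c \<longleftrightarrow> chain_len F c 0 (Suc y) = Suc (chain_len F c 0 y))"
    if "k \<le> y" "y + k < n" for y
    using that by (simp add: hor_0[OF XE])
  \<comment> \<open>Outside \<open>F\<close> the point is a comparator: the larger name leaves
    rightward, the smaller one upward, which matches the maximum in the recursion. In
    \<open>F\<close> both beams turn regardless of their names.\<close>
  have local_rule: "(hor X (Suc x) y \<le> c \<longleftrightarrow>
      chain_len F c (Suc x) (Suc y) = Suc (chain_len F c (Suc x) y)) \<and>
      (ver X x (Suc y) \<le> c \<longleftrightarrow> chain_len F c (Suc x) (Suc y) = chain_len F c x (Suc y))"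
    if xy: "y < n" "x + k < y" "y + k < x + n" "c < y"
      and H: "hor X x y \<le> c \<longleftrightarrow> chain_len F c x (Suc y) = Suc (chain_len F c x y)"
      and V: "ver X x y \<le> c \<longleftrightarrow> chain_len F c (Suc x) y = chain_len F c x y" for x y
  proof -
    have in_X: "x * n + y \<in> X \<longleftrightarrow> (x, y) \<notin> F \<and> ver X x y < hor X x y"
      using X xy by (simp add: greedy_for_def)
    have out: "hor X (Suc x) y = (if x * n + y \<in> X then hor X x y else ver X x y)"
      "ver X x (Suc y) = (if x * n + y \<in> X then ver X x y else hor X x y)"
      using xy by (auto simp: hor_Suc[OF XE] ver_Suc[OF XE])
    have neq: "hor X x y \<noteq> ver X x y" using hor_neq_ver xy by simp
    have rec: "chain_len F c (Suc x) (Suc y) = max (max (chain_len F c x (Suc y)) (chain_len F c (Suc x) y))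
       (chain_len F c x y + (if (x, y) \<in> F then 1 else 0))" using xy by simp
    have s: "chain_len F c x (Suc y) = chain_len F c x y \<or> chain_len F c x (Suc y) = Suc (chain_len F c x y)"
      "chain_len F c (Suc x) y = chain_len F c x y \<or> chain_len F c (Suc x) y = Suc (chain_len F c x y)"
      using step[of F c x y] by (auto simp del: chain_len.simps)
    show ?thesis
    proof (cases "(x, y) \<in> F")
      case True
      then show ?thesis unfolding out rec using s H V in_X by (auto simp del: chain_len.simps)
    next
      case False
      then show ?thesis unfolding out rec in_X using s H V neq by (auto simp del: chain_len.simps)
    qed
  qed
  {
    fix x y
    assume xy: "y < n" "x + k < y" "y + k \<le> x + n"
      and V: "x \<le> c \<longrightarrow> c < y \<longrightarrow> (ver X x y \<le> c \<longleftrightarrow> chain_len F c (Suc x) y = chain_len F c x y)"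
      and H: "y + k < x + n \<Longrightarrow> x \<le> c \<longrightarrow> c < y \<longrightarrow>
        (hor X x y \<le> c \<longleftrightarrow> chain_len F c x (Suc y) = Suc (chain_len F c x y))"
    show "Suc x \<le> c \<longrightarrow> c < y \<longrightarrow> (hor X (Suc x) y \<le> c \<longleftrightarrow>
        chain_len F c (Suc x) (Suc y) = Suc (chain_len F c (Suc x) y))"
    proof (intro impI)
      assume xc: "Suc x \<le> c" "c < y"
      show "hor X (Suc x) y \<le> c \<longleftrightarrow> chain_len F c (Suc x) (Suc y) = Suc (chain_len F c (Suc x) y)"
      proof (cases "y + k < x + n")
        case True
        then show ?thesis using local_rule[of y x] xy xc H V by simp
      next
        \<comment> \<open>On the upper boundary the irrelevant edges make both chain lengths below
          as large as the number of columns.\<close>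
        case False
        then have "x * n + y \<notin> X" using time_in_X[OF XE, of y x] xy by auto
        then have "hor X (Suc x) y = ver X x y" using xy by (simp add: hor_Suc[OF XE])
        moreover have "chain_len F c (Suc x) (Suc y) = Suc x" "chain_len F c x y = x"
          using chain_len_corner[OF F c, of "Suc x" "Suc y"] chain_len_corner[OF F c, of x y] xy False
          by (auto simp del: chain_len.simps)
        ultimately show ?thesis using V xc by (auto simp del: chain_len.simps)
      qed
    qed
  }
  {
    fix x y
    assume xy: "y < n" "x + k \<le> y" "y + k < x + n"
      and H: "x \<le> c \<longrightarrow> c < y \<longrightarrow>
        (hor X x y \<le> c \<longleftrightarrow> chain_len F c x (Suc y) = Suc (chain_len F c x y))"
      and V: "x + k < y \<Longrightarrow> x \<le> c \<longrightarrow> c < y \<longrightarrow>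
        (ver X x y \<le> c \<longleftrightarrow> chain_len F c (Suc x) y = chain_len F c x y)"
    show "x \<le> c \<longrightarrow> c < Suc y \<longrightarrow> (ver X x (Suc y) \<le> c \<longleftrightarrow>
        chain_len F c (Suc x) (Suc y) = chain_len F c x (Suc y))"
    proof (intro impI)
      assume xc: "x \<le> c" "c < Suc y"
      show "ver X x (Suc y) \<le> c \<longleftrightarrow> chain_len F c (Suc x) (Suc y) = chain_len F c x (Suc y)"
      proof (cases "c = y")
        \<comment> \<open>Counting starts above row \<open>c\<close>, so both chain lengths are 0;
          and the beam has started in a row up to \<open>y = c\<close>.\<close>
        case True
        then show ?thesis using beam_row_bound[OF XE, of x "Suc y"] xy by auto
      next
        case False
        then have cy: "c < y" using xc by simp
        show ?thesis
        proof (cases "x + k < y")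
          case True
          then show ?thesis using local_rule[of y x] xy xc cy H V by simp
        next
          case False
          \<comment> \<open>On the lower boundary the irrelevant edge is a mirror turning the single
            beam upward.\<close>
          then have y: "y = x + k" using xy by simp
          then have "x * n + y \<notin> X" using time_in_X[OF XE, of y x] xy by auto
          then have v: "ver X x (Suc y) = hor X x y" using xy by (simp add: ver_Suc[OF XE])
          have "(x, y) \<in> F" using F xy y k_pos by (auto simp: irrelevant_edges_def)
          then have "chain_len F c (Suc x) (Suc y) =
              max (max (chain_len F c x (Suc y)) (chain_len F c (Suc x) y)) (Suc (chain_len F c x y))"
            using cy by simp
          then show ?thesis using v H xc cy step[of F c x y] by (auto simp del: chain_len.simps)
        qed
      qed
    qed
  }
qed

section \<open>The k-triangulations as reduced arrangements\<close>

definition edges_of :: "nat set \<Rightarrow> edge set" where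
  "edges_of X = {(u, v) \<in> polygon_edges n. u * n + v \<notin> X}"

text \<open>Later columns act only on lower levels, so the line leaving column \<open>x\<close> at
  the top keeps its level.\<close>

lemma final_state:
  assumes X: "X \<subseteq> relevant_times" and x: "x < n"
  shows "state X (n * n) (n - Suc x) = ver X x n"
proof -
  have "state X (n * n) (n - Suc x) = state X (Suc x * n + 0) (n - Suc x)"
  proof (rule state_between_cells[OF X])
    show "Suc x * n + 0 \<le> n * n" using x mult_le_mono1[of "Suc x" n n] by simp
    fix x' y' assume A: "y' < n" "x' + k < y'" "Suc x * n + 0 \<le> x' * n + y'"
    have "\<not> x' * n + y' < Suc x * n + 0" using A(3) by simp
    then have "Suc x \<le> x'" using time_less[of y' 0 x' "Suc x"] A(1) by auto
    then show "y' - x' \<noteq> n - Suc x \<and> y' - Suc x' \<noteq> n - Suc x" using A by auto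
  qed
  then show ?thesis by (simp add: ver_def add.commute)
qed

text \<open>For \<open>k \<le> c < n - k\<close>, the chain length over all rows is \<open>k\<close>
  after \<open>k\<close> columns, and up to column \<open>c\<close> it grows exactly at columns left
  at the top by an unmarked beam. Under reversal the beam leaving column \<open>x\<close> is
  \<open>x\<close>, so nothing grows; conversely, no growth bounds the beam leaving column
  \<open>c\<close> by \<open>c\<close>, and the names are determined one after the other. Any other
  \<open>c\<close> leaves at most \<open>k\<close> columns or rows.\<close>

lemma reversed_iff_chain_len:
  assumes F: "irrelevant_edges \<subseteq> F" and X: "greedy_for F X"
  shows "reversed X \<longleftrightarrow> (\<forall>c. chain_len F c (Suc c) n \<le> k)"
proof
  have XE: "X \<subseteq> relevant_times" using X by (simp add: greedy_for_def)
  have marks: "ver X x n \<le> c \<longleftrightarrow> chain_len F c (Suc x) n = chain_len F c x n"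
    if "k \<le> x" "x \<le> c" "c + k < n" for x c
    using beam_marks[OF F X that(3), of x n] that by auto
  {
    assume rev: "reversed X"
    show "\<forall>c. chain_len F c (Suc c) n \<le> k"
    proof
      fix c
      consider "c < k" | "k \<le> c" "c + k < n" | "n \<le> c + k" by linarith
      then show "chain_len F c (Suc c) n \<le> k"
      proof cases
        case 1
        then show ?thesis using chain_len_le_cols[of F c "Suc c" n] by simp
      next
        case 3
        then show ?thesis using chain_len_le_rows[of F c "Suc c" n] by simp
      next
        case 2
        have eq: "chain_len F c (Suc x) n = chain_len F c x n" if "k \<le> x" "x \<le> c" for x
        proof -
          have "n - Suc x \<in> {k..<n - k}" using that 2 by auto
          then have "state X (n * n) (n - Suc x) = x" using rev that 2 by (simp add: reversed_def)
          then have "ver X x n = x" using final_state[OF XE, of x] that 2 by simp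
          then show ?thesis using marks[OF that 2(2)] that(2) by simp
        qed
        have "chain_len F c x n = chain_len F c k n" if "k \<le> x" "x \<le> Suc c" for x
          using that
        proof (induction rule: dec_induct)
          case (step m)
          then show ?case using eq[of m] by simp
        qed simp
        then show ?thesis using 2 chain_len_corner[OF F 2(2), of k n] by simp
      qed
    qed
  }
  {
    assume le: "\<forall>c. chain_len F c (Suc c) n \<le> k"
    have ver: "ver X c n \<le> c" if "k \<le> c" "c + k < n" for c
    proof -
      have "chain_len F c k n \<le> chain_len F c c n"
        using that(1) chain_len_mono_col by (rule lift_Suc_mono_le[rotated])
      moreover have "chain_len F c k n = k" using chain_len_corner[OF F that(2), of k n] by simp
      moreover have "chain_len F c c n \<le> chain_len F c (Suc c) n" by (rule chain_len_mono_col)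
      moreover have "chain_len F c (Suc c) n \<le> k" using le by blast
      ultimately show ?thesis using marks[of c c] that by simp
    qed
    have fin: "state X (n * n) (n - Suc c) = c" if "k \<le> c" "c + k < n" for c
      using that
    proof (induction c rule: less_induct)
      case (less c)
      define w where "w = state X (n * n) (n - Suc c)"
      have "w \<le> c" using ver less final_state[OF XE, of c] by (simp add: w_def)
      moreover have "k \<le> w"
        using state_in_range[OF XE, of "n * n" "n - Suc c"] less by (auto simp: w_def)
      ultimately have "w \<noteq> c \<Longrightarrow> state X (n * n) (n - Suc w) = w" using less by auto
      then have "w \<noteq> c \<Longrightarrow> n - Suc w = n - Suc c" unfolding w_def by (metis state_eq_iff)
      then show ?case using \<open>w \<le> c\<close> less.prems w_def by fastforce
    qed
    show "reversed X" unfolding reversed_def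
    proof
      fix d assume d: "d \<in> {k..<n - k}"
      then have "n - Suc (n - Suc d) = d" "k \<le> n - Suc d" "n - Suc d + k < n"
        "k + (n - k) - 1 - d = n - Suc d" by auto
      then show "state X (n * n) d = k + (n - k) - 1 - d" using fin[of "n - Suc d"] by simp
    qed
  }
qed

lemma irrelevant_edges_subset_edges_of:
  "X \<subseteq> relevant_times \<Longrightarrow> irrelevant_edges \<subseteq> edges_of X"
  using time_in_X[of X] by (fastforce simp: irrelevant_edges_def edges_of_def polygon_edges_def)

lemma reduced_greedy_for:
  assumes X: "reduced X" shows "greedy_for (edges_of X) X"
proof -
  have XE: "X \<subseteq> relevant_times" using X by (simp add: reduced_def)
  have "ver X x y < hor X x y" if "x * n + y \<in> X" "y < n" "x < y" for x y
    using reduced_lower_less_upper[OF X that(1)] that by (simp add: lower_time[OF XE] upper_time[OF XE])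
  then show ?thesis using XE by (auto simp: greedy_for_def edges_of_def polygon_edges_def)
qed

lemma crossing_free_edges_of:
  assumes "reduced X" shows "crossing_free (k + 1) (edges_of X)"
proof -
  have XE: "X \<subseteq> relevant_times" "reversed X" using assms by (auto simp: reduced_def)
  have "edges_of X \<subseteq> polygon_edges n" by (auto simp: edges_of_def)
  from crossing_free_iff_chain_len[OF this, of k] show ?thesis
    using reversed_iff_chain_len[OF irrelevant_edges_subset_edges_of[OF XE(1)] reduced_greedy_for[OF assms]] XE
    by simp
qed

text \<open>A greedy arrangement that crosses only outside \<open>F\<close> is reversed by the 0-1
  principle, and it is reduced since all its crossings are increasing.\<close>

lemma crossing_free_extends:
  assumes F: "F \<subseteq> polygon_edges n" "irrelevant_edges \<subseteq> F" "crossing_free (k + 1) F"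
  shows "\<exists>X. reduced X \<and> F \<subseteq> edges_of X"
proof -
  define A where "A = {x * n + y | x y. y < n \<and> x + k < y \<and> y + k < x + n \<and> (x, y) \<notin> F}"
  have inA: "x * n + y \<in> A \<longleftrightarrow> x + k < y \<and> y + k < x + n \<and> (x, y) \<notin> F" if "y < n" for x y
    using that by (auto simp: A_def)
  have AE: "A \<subseteq> relevant_times" by (auto simp: A_def)
  obtain X where X: "X \<subseteq> A" "\<forall>t\<in>A. t \<in> X \<longleftrightarrow> lower X t < upper X t"
    using greedy_exists[OF AE] by metis
  then have XE: "X \<subseteq> relevant_times" using AE by blast
  have "greedy_for F X" unfolding greedy_for_def
  proof (intro conjI allI impI)
    fix x y assume xy: "y < n \<and> x + k < y \<and> y + k < x + n"
    have "x * n + y \<in> X \<Longrightarrow> (x, y) \<notin> F" using X(1) inA[of y x] xy by auto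
    moreover have "(x, y) \<notin> F \<Longrightarrow> x * n + y \<in> X \<longleftrightarrow> ver X x y < hor X x y"
      using X(2) inA[of y x] xy lower_time[OF XE, of y x] upper_time[OF XE, of y x] by simp
    ultimately show "x * n + y \<in> X \<longleftrightarrow> (x, y) \<notin> F \<and> ver X x y < hor X x y" by blast
  qed (rule XE)
  then have "reversed X"
    using reversed_iff_chain_len[OF F(2)] crossing_free_iff_chain_len[OF F(1), of k] F(3) by simp
  then have "reduced X" using increasing_imp_reduced[OF XE] X by auto
  moreover have "F \<subseteq> edges_of X"
  proof
    fix e assume e: "e \<in> F"
    obtain x y where xy: "e = (x, y)" by fastforce
    then have "y < n" "e \<in> polygon_edges n" using e F(1) by (auto simp: polygon_edges_def)
    then show "e \<in> edges_of X" using X(1) inA[of y x] e xy by (auto simp: edges_of_def)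
  qed
  ultimately show ?thesis by blast
qed

text \<open>If \<open>e\<close> completed a crossing of size \<open>k + 1\<close>, the other
  \<open>k\<close> edges would have \<open>k\<close> distinct endpoints strictly on each side of
  \<open>e\<close>, but one side has fewer than \<open>k\<close> vertices.\<close>

lemma irrelevant_edges_subset_triangulation:
  assumes T: "k_triangulation n k T"
  shows "irrelevant_edges \<subseteq> T"
proof
  fix e assume e: "e \<in> irrelevant_edges"
  obtain u v where uv: "e = (u, v)" by fastforce
  have uvn: "u < v" "v < n" "v \<le> u + k \<or> u + n \<le> v + k"
    using e uv by (auto simp: irrelevant_edges_def)
  have "crossing_free (k + 1) (insert e T)" unfolding crossing_free_def
  proof (rule notI, clarify)
    fix S assume S: "S \<subseteq> insert e T" "crossing (k + 1) S"
    then have fin: "finite S" "card S = k + 1" "pairwise crosses S" by (auto simp: crossing_def)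
    have "e \<in> S"
    proof (rule ccontr)
      assume "e \<notin> S"
      then have "S \<subseteq> T" using S(1) by auto
      then show False using T S(2) by (auto simp: k_triangulation_def crossing_free_def)
    qed
    define S' where "S' = S - {e}"
    have card: "card S' = k" "finite S'" using fin \<open>e \<in> S\<close> by (auto simp: S'_def)
    have cr: "crosses (a, b) (u, v)" "b < n" if "(a, b) \<in> S'" for a b
    proof -
      show "crosses (a, b) (u, v)" using fin(3) that \<open>e \<in> S\<close> uv unfolding S'_def pairwise_def by blast
      have "(a, b) \<in> T" using that S(1) by (auto simp: S'_def)
      then show "b < n" using T by (auto simp: k_triangulation_def polygon_edges_def)
    qed
    have dist: "a \<noteq> a' \<and> b \<noteq> b' \<and> a \<noteq> b' \<and> b \<noteq> a'"
      if "(a, b) \<in> S'" "(a', b') \<in> S'" "(a, b) \<noteq> (a', b')" for a b a' b'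
    proof -
      have "crosses (a, b) (a', b')" using fin(3) that unfolding S'_def pairwise_def by blast
      then show ?thesis by auto
    qed
    define inner where "inner = (\<lambda>(a, b). if u < a \<and> a < v then a else b)"
    define outer where "outer = (\<lambda>(a, b). if u < a \<and> a < v then b else a)"
    have "inj_on inner S'" "inj_on outer S'"
      unfolding inj_on_def inner_def outer_def using dist by (auto split: if_splits) blast+
    moreover have "inner ` S' \<subseteq> {u<..<v}" "outer ` S' \<subseteq> {..<u} \<union> {v<..<n}"
      using cr by (auto simp: inner_def outer_def) (metis crosses.simps not_less_iff_gr_or_eq)+
    ultimately have "k \<le> card {u<..<v}" "k \<le> card ({..<u} \<union> {v<..<n})"
      using card(1) card_inj_on_le[of inner S' "{u<..<v}"]
        card_inj_on_le[of outer S' "{..<u} \<union> {v<..<n}"] by blast+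
    moreover have "card ({..<u} \<union> {v<..<n}) \<le> u + (n - Suc v)"
      using card_Un_le[of "{..<u}" "{v<..<n}"] by simp
    ultimately show False using uvn k_pos by auto
  qed
  moreover have "insert e T \<subseteq> polygon_edges n"
    using T uvn uv by (auto simp: k_triangulation_def polygon_edges_def)
  ultimately have "insert e T = T" using T unfolding k_triangulation_def by blast
  then show "e \<in> T" by blast
qed

lemma edges_of_subset_imp_eq:
  assumes "reduced X" "reduced Y" "edges_of X \<subseteq> edges_of Y"
  shows "X = Y"
proof -
  have "Y \<subseteq> X"
  proof
    fix t assume "t \<in> Y"
    moreover from this have "t \<in> relevant_times" using assms(2) by (auto simp: reduced_def)
    then obtain x y where "t = x * n + y" "y < n" "x + k < y" by (rule relevant_timesE)
    moreover from this have "(x, y) \<in> polygon_edges n" by (simp add: polygon_edges_def)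
    ultimately show "t \<in> X" using subsetD[OF assms(3), of "(x, y)"] by (auto simp: edges_of_def)
  qed
  then show ?thesis
    using reduced_card_eq[OF assms(1,2)] finite_reduced[OF assms(1)] by (metis card_subset_eq)
qed

text \<open>The sets \<open>edges_of X\<close> are pairwise incomparable because reduced sets have
  equal size, and every crossing-free set containing the irrelevant edges lies in one of
  them.\<close>

theorem k_triangulation_iff_reduced:
  "k_triangulation n k T \<longleftrightarrow> (\<exists>X. reduced X \<and> T = edges_of X)"
proof
  assume T: "k_triangulation n k T"
  then have "T \<subseteq> polygon_edges n" "crossing_free (k + 1) T" by (auto simp: k_triangulation_def)
  then obtain X where X: "reduced X" "T \<subseteq> edges_of X"
    using crossing_free_extends irrelevant_edges_subset_triangulation[OF T] by blast
  moreover have "edges_of X \<subseteq> polygon_edges n" by (auto simp: edges_of_def)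
  ultimately have "edges_of X = T" using T crossing_free_edges_of[OF X(1)] unfolding k_triangulation_def by blast
  then show "\<exists>X. reduced X \<and> T = edges_of X" using X(1) by blast
next
  assume "\<exists>X. reduced X \<and> T = edges_of X"
  then obtain X where X: "reduced X" "T = edges_of X" by blast
  show "k_triangulation n k T" unfolding k_triangulation_def
  proof (intro conjI allI impI)
    show "T \<subseteq> polygon_edges n" using X(2) by (auto simp: edges_of_def)
    show "crossing_free (k + 1) T" using X crossing_free_edges_of by simp
    fix F assume F: "T \<subseteq> F \<and> F \<subseteq> polygon_edges n \<and> crossing_free (k + 1) F"
    have "irrelevant_edges \<subseteq> F"
      using irrelevant_edges_subset_edges_of[of X] X F by (auto simp: reduced_def)
    then obtain Y where Y: "reduced Y" "F \<subseteq> edges_of Y" using crossing_free_extends F by blast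
    then have "X = Y" using edges_of_subset_imp_eq[OF X(1) Y(1)] X(2) F by blast
    then show "F = T" using Y X F by blast
  qed
qed

end

section \<open>Stars and beams\<close>

context
  fixes n k :: nat and T :: "edge set"
  assumes free: "crossing_free (k + 1) T"
begin

context
  fixes s assumes star: "k_star_of n k T s"
begin

lemma star_nth_less: "i < j \<Longrightarrow> j < 2 * k + 1 \<Longrightarrow> s ! i < s ! j"
  using star by (auto simp: k_star_of_def sorted_wrt_nth_less)

lemma star_edge_mem:
  "j \<le> k \<Longrightarrow> (s ! j, s ! (k + j)) \<in> T" "j < k \<Longrightarrow> (s ! j, s ! (k + j + 1)) \<in> T"
  using star unfolding k_star_of_def using star_edges_eq[of s k] by blast+

text \<open>An edge of \<open>T\<close> in such a gap would form a \<open>(k + 1)\<close>-crossing with edges of the star.\<close>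

lemma star_row_gap:
  assumes j: "j \<le> k" and u: "u < s ! j" "j > 0 \<Longrightarrow> s ! (j - 1) < u"
  shows "(u, s ! (k + j)) \<notin> T"
proof
  assume T: "(u, s ! (k + j)) \<in> T"
  \<comment> \<open>The edges \<open>(s ! i, s ! (k + i))\<close> before \<open>j\<close> and
    \<open>(s ! (i - 1), s ! (k + i))\<close> after \<open>j\<close> leave the row
    \<open>s ! (k + j)\<close> free for the new edge.\<close>
  define a where "a = (\<lambda>i. if i < j then s ! i else if i = j then u else s ! (i - 1))"
  have "\<not> crossing_free (k + 1) T"
  proof (rule not_crossing_free[where a = a and b = "\<lambda>i. s ! (k + i)"])
    show "(a i, s ! (k + i)) \<in> T" if "i \<le> k" for i
      using that T star_edge_mem(1)[of i] star_edge_mem(2)[of "i - 1"] by (auto simp: a_def)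
    have lo: "s ! i < u" if "i < j" for i
    proof -
      have "i = j - 1 \<or> i < j - 1" "j - 1 < 2 * k + 1" using that j by linarith+
      then show ?thesis using that u(2) star_nth_less[of i "j - 1"] by auto
    qed
    have hi: "u < s ! i" if "j \<le> i" "i < 2 * k + 1" for i
      using that u(1) star_nth_less[of j i] by (cases "i = j") auto
    show "a i < a i' \<and> s ! (k + i) < s ! (k + i')" if "i < i'" "i' \<le> k" for i i'
      using that star_nth_less[of i i'] star_nth_less[of i "i' - 1"] star_nth_less[of "i - 1" "i' - 1"]
        lo[of i] hi[of "i' - 1"] star_nth_less[of "k + i" "k + i'"] j
      by (auto simp: a_def)
    show "a k < s ! (k + 0)"
      using j hi[of k] star_nth_less[of "k - 1" k] by (auto simp: a_def)
  qed
  then show False using free by simp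
qed

text \<open>Here the columns are fixed: the longer star edge is used in each column before
  \<open>j\<close>, the shorter one after \<open>j\<close>.\<close>

lemma star_column_gap:
  assumes j: "j < k" and y: "s ! (k + j) < y" "y < s ! (k + j + 1)"
  shows "(s ! j, y) \<notin> T"
proof
  assume T: "(s ! j, y) \<in> T"
  define b where "b = (\<lambda>i. if i < j then s ! (k + i + 1) else if i = j then y else s ! (k + i))"
  have "\<not> crossing_free (k + 1) T"
  proof (rule not_crossing_free[where a = "\<lambda>i. s ! i" and b = b])
    show "(s ! i, b i) \<in> T" if "i \<le> k" for i
      using that T star_edge_mem(1)[of i] star_edge_mem(2)[of i] j by (auto simp: b_def)
    have lo: "s ! i < y" if "i \<le> k + j" for i
      using that y(1) star_nth_less[of i "k + j"] j by (cases "i = k + j") auto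
    have hi: "y < s ! i" if "k + j < i" "i < 2 * k + 1" for i
      using that y(2) star_nth_less[of "k + j + 1" i] by (cases "i = k + j + 1") auto
    show "s ! i < s ! i' \<and> b i < b i'" if "i < i'" "i' \<le> k" for i i'
      using that star_nth_less[of i i'] star_nth_less[of "k + i + 1" "k + i' + 1"]
        star_nth_less[of "k + i + 1" "k + i'"] star_nth_less[of "k + i" "k + i'"]
        lo[of "k + i + 1"] hi[of "k + i'"] j
      by (auto simp: b_def)
    show "s ! k < b 0"
      using j lo[of k] star_nth_less[of k "k + 1"] by (auto simp: b_def)
  qed
  then show False using free by simp
qed

end

text \<open>From the row \<open>s ! k\<close> on, the staircase is determined step by step: if the
  next columns or rows of two stars differed, the smaller one would give an edge of \<open>T\<close>
  in a gap of the other star.\<close>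

lemma star_unique:
  assumes s: "k_star_of n k T s" and s': "k_star_of n k T s'" and mid: "s ! k = s' ! k"
  shows "s = s'"
proof -
  have col: "\<not> s1 ! j < s2 ! j"
    if st: "k_star_of n k T s1" "k_star_of n k T s2" and eq: "s1 ! (k + j) = s2 ! (k + j)"
      "j > 0 \<Longrightarrow> s1 ! (j - 1) = s2 ! (j - 1)" and j: "j \<le> k" for s1 s2 j
  proof
    assume "s1 ! j < s2 ! j"
    then have "(s1 ! j, s2 ! (k + j)) \<notin> T"
      using star_row_gap[OF st(2) j, of "s1 ! j"] eq(2) star_nth_less[OF st(1), of "j - 1" j] j by auto
    then show False using star_edge_mem(1)[OF st(1) j] eq(1) by simp
  qed
  have row: "\<not> s1 ! (k + j + 1) < s2 ! (k + j + 1)"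
    if st: "k_star_of n k T s1" "k_star_of n k T s2" and eq: "s1 ! (k + j) = s2 ! (k + j)"
      "s1 ! j = s2 ! j" and j: "j < k" for s1 s2 j
  proof
    assume "s1 ! (k + j + 1) < s2 ! (k + j + 1)"
    then have "(s2 ! j, s1 ! (k + j + 1)) \<notin> T"
      using star_column_gap[OF st(2) j] eq(1) star_nth_less[OF st(1), of "k + j" "k + j + 1"] j by auto
    then show False using star_edge_mem(2)[OF st(1) j] eq(2) by simp
  qed
  have "(\<forall>i<j. s ! i = s' ! i) \<and> (\<forall>i\<le>j. s ! (k + i) = s' ! (k + i))" if "j \<le> k" for j
    using that
  proof (induction j)
    case (Suc j)
    have IH: "s ! i = s' ! i" "s ! (k + i') = s' ! (k + i')" if "i < j" "i' \<le> j" for i i'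
      using Suc that by auto
    have IH': "s ! (k + j) = s' ! (k + j)" using Suc by auto
    have jk: "j \<le> k" "j < k" using Suc.prems by auto
    have 1: "s ! j = s' ! j"
      using col[OF s s' IH' _ jk(1)] col[OF s' s IH'[symmetric] _ jk(1)] IH(1)[of "j - 1" 0]
      by (metis diff_less le0 less_one linorder_neqE_nat)
    then have "s ! (k + j + 1) = s' ! (k + j + 1)"
      using row[OF s s' IH' 1 jk(2)] row[OF s' s IH'[symmetric] 1[symmetric] jk(2)] by linarith
    then show ?case using 1 Suc jk by (auto simp: less_Suc_eq le_Suc_eq)
  qed (use mid in simp)
  from this[of k] have *: "\<And>i. i < k \<Longrightarrow> s ! i = s' ! i" "\<And>i. i \<le> k \<Longrightarrow> s ! (k + i) = s' ! (k + i)" by auto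
  have "s ! i = s' ! i" if "i < 2 * k + 1" for i
    using *(1)[of i] *(2)[of "i - k"] that by (cases "i < k") auto
  then show ?thesis using s s' by (intro nth_equalityI) (auto simp: k_star_of_def)
qed

end

section \<open>The course of a single beam and its star\<close>

locale beam = polygon +
  fixes X :: "nat set" and a :: nat
  assumes X: "reduced X" and a_lo: "k \<le> a" and a_hi: "a + k < n"
begin

lemma XE: "X \<subseteq> relevant_times"
  using X by (simp add: reduced_def)

text \<open>The row in which the beam \<open>a\<close> enters column \<open>u\<close>; it is at least \<open>n\<close> once the beam has left the grid.\<close>

definition row :: "nat \<Rightarrow> nat" where
  "row u = u + pos X (u * n) a"

text \<open>The mirror in column \<open>a\<close> is excluded: there the beam turns upward for the
  last time and leaves the grid.\<close>

definition turns :: "nat set" where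
  "turns = {u. u < a \<and> u * n + row u \<notin> X}"

lemma hor_eq_state:
  assumes "y < n" "u \<le> y" shows "hor X u y = state X (u * n) (y - u)"
  unfolding hor_def
proof (rule state_between_cells[OF XE])
  fix x' y' assume A: "y' < n" "x' + k < y'" "u * n \<le> x' * n + y'" "x' * n + y' < u * n + y"
  then have "\<not> x' * n + y' < u * n + 0" by simp
  then have "x' = u" "y' < y"
    using A assms time_less[of y' 0 x' u] time_less[of y' y x' u] by auto
  then show "y' - x' \<noteq> y - u \<and> y' - Suc x' \<noteq> y - u" using A by auto
qed simp

lemma hor_iff_row: "y < n \<Longrightarrow> u \<le> y \<Longrightarrow> hor X u y = a \<longleftrightarrow> row u = y"
  using pos_eq[of X "u * n" a "y - u"] by (auto simp: hor_eq_state row_def)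

lemma pos_in_range: "k \<le> pos X t a" "pos X t a + k < n"
  using state_in_range[OF XE, of t "pos X t a"] a_lo a_hi by auto

lemma row_bounds: "u + k \<le> row u" "row u + k < u + n"
  using pos_in_range[of "u * n"] by (auto simp: row_def)

lemma row_0 [simp]: "row 0 = a"
  by (simp add: row_def)

lemma row_above_mirror:
  assumes "ver X u y = a" "u + k < y" "y \<le> n" "y + k \<le> u + n"
  shows "y \<le> row (Suc u) \<and> row (Suc u) \<le> n \<and>
    (row (Suc u) < n \<longrightarrow> (u, row (Suc u)) \<in> edges_of X)"
  using assms
proof (induction "n - y" arbitrary: y)
  case 0
  then have "y = n" by simp
  then have "state X (Suc u * n) (n - Suc u) = a" using 0 by (simp add: ver_def add.commute)
  then have "pos X (Suc u * n) a = n - Suc u" by (simp add: pos_eq)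
  then have "row (Suc u) = n" using 0 \<open>y = n\<close> by (simp add: row_def)
  then show ?case using \<open>y = n\<close> by simp
next
  case (Suc m)
  then have "y < n" by simp
  show ?case
  proof (cases "u * n + y \<in> X")
    case True
    then have "ver X u (Suc y) = a" "Suc y + k \<le> u + n"
      using Suc.prems \<open>y < n\<close> time_in_X[OF XE \<open>y < n\<close>, of u] by (auto simp: ver_Suc[OF XE])
    moreover have "m = n - Suc y" "u + k < Suc y" "Suc y \<le> n" using Suc \<open>y < n\<close> by auto
    ultimately show ?thesis using Suc(1)[of "Suc y"] by auto
  next
    case False
    then have "hor X (Suc u) y = a" using Suc.prems \<open>y < n\<close> by (simp add: hor_Suc[OF XE])
    then have "row (Suc u) = y" using hor_iff_row[of y "Suc u"] \<open>y < n\<close> Suc.prems by simp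
    then show ?thesis using False \<open>y < n\<close> Suc.prems by (auto simp: edges_of_def polygon_edges_def)
  qed
qed

lemma row_step:
  assumes "row u < n"
  obtains "u * n + row u \<in> X" "row (Suc u) = row u"
  | "u * n + row u \<notin> X" "(u, row u) \<in> edges_of X" "row u < row (Suc u)" "row (Suc u) \<le> n"
      "row (Suc u) < n \<Longrightarrow> (u, row (Suc u)) \<in> edges_of X"
proof -
  have u: "u < row u" using row_bounds[of u] k_pos by simp
  have h: "hor X u (row u) = a" using hor_iff_row[of "row u" u] assms u by simp
  show ?thesis
  proof (cases "u * n + row u \<in> X")
    case True
    then have "u + k < row u" using time_in_X[OF XE assms] by blast
    then have "hor X (Suc u) (row u) = a" using True h by (simp add: hor_Suc[OF XE assms])
    then have "row (Suc u) = row u" using hor_iff_row[of "row u" "Suc u"] assms u by simp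
    then show ?thesis using True that(1) by blast
  next
    case False
    then have "ver X u (Suc (row u)) = a" using h row_bounds[of u] by (simp add: ver_Suc[OF XE assms])
    then have "Suc (row u) \<le> row (Suc u) \<and> row (Suc u) \<le> n \<and>
        (row (Suc u) < n \<longrightarrow> (u, row (Suc u)) \<in> edges_of X)"
      using row_above_mirror[of u "Suc (row u)"] row_bounds[of u] assms by simp
    moreover have "(u, row u) \<in> edges_of X"
      using False assms u by (simp add: edges_of_def polygon_edges_def)
    ultimately show ?thesis using that(2) False by simp
  qed
qed

lemma final_pos: "pos X (n * n) a = n - Suc a"
  using reversed_pos[of X a] X a_lo a_hi by (simp add: reduced_def)

lemma pos_outside:
  assumes "n \<le> row u" "u * n \<le> t" shows "pos X t a = pos X (u * n) a"
proof -
  let ?p = "pos X (u * n) a"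
  have "state X t ?p = state X (u * n) ?p"
  proof (rule state_between_cells[OF XE assms(2)])
    fix x' y' assume A: "y' < n" "u * n \<le> x' * n + y'"
    then have "\<not> x' * n + y' < u * n + 0" by simp
    then have "u \<le> x'" using A time_less[of y' 0 x' u] by auto
    then show "y' - x' \<noteq> ?p \<and> y' - Suc x' \<noteq> ?p"
      using A assms(1) pos_in_range(1)[of "u * n"] k_pos by (auto simp: row_def)
  qed
  then show ?thesis by (simp add: pos_eq)
qed

text \<open>Outside the grid the beam takes part in no further crossing, so it already has its final
  level, which the reversal fixes.\<close>

lemma row_outside:
  assumes "n \<le> row u" "u \<le> n" shows "a < u" "pos X (u * n) a = n - Suc a"
proof -
  show "pos X (u * n) a = n - Suc a"
    using pos_outside[OF assms(1), of "n * n"] final_pos assms(2) by simp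
  then show "a < u" using assms(1) a_hi by (auto simp: row_def)
qed

lemma row_inside: "u \<le> a \<Longrightarrow> row u < n"
  using row_outside(1)[of u] a_hi by (cases "n \<le> row u") auto

text \<open>Leaving the grid in column \<open>u\<close> means ending at level
  \<open>n - Suc u\<close>; the reversal makes this \<open>n - Suc a\<close>, so
  \<open>u = a\<close>.\<close>

lemma row_exit: "row (Suc a) = n"
proof -
  have ex: "\<exists>u<w. row u < n \<and> n \<le> row (Suc u)" if "n \<le> row w" for w
    using that
  proof (induction w)
    case 0
    then show ?case using row_inside[of 0] by simp
  next
    case (Suc w)
    then show ?case by (cases "n \<le> row w") (auto intro: less_SucI)
  qed
  have "n \<le> row n" by (simp add: row_def)
  then obtain u where u: "u < n" "row u < n" "n \<le> row (Suc u)" using ex by blast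
  have "row (Suc u) = n" using row_step[OF u(2)] u by (metis le_antisym leD)
  moreover from this have "pos X (Suc u * n) a = n - Suc u" by (simp add: row_def)
  then have "u = a" using row_outside(2)[OF u(3)] u(1) a_hi by simp
  ultimately show ?thesis by simp
qed

lemma last_mirror: "(a, row a) \<in> edges_of X" "a * n + row a \<notin> X"
  using row_step[OF row_inside[of a]] row_exit row_inside[of a] by (metis less_irrefl order_refl)+

lemma row_turn:
  assumes "u \<in> turns"
  shows "(u, row u) \<in> edges_of X" "row u < row (Suc u)" "row (Suc u) < n" "(u, row (Suc u)) \<in> edges_of X"
proof -
  have u: "u < a" "u * n + row u \<notin> X" "row u < n" "row (Suc u) < n"
    using assms row_inside[of u] row_inside[of "Suc u"] by (auto simp: turns_def)
  then show "(u, row u) \<in> edges_of X" "row u < row (Suc u)" "row (Suc u) < n" "(u, row (Suc u)) \<in> edges_of X"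
    using row_step[OF u(3)] by metis+
qed

lemma row_straight: "u < a \<Longrightarrow> u \<notin> turns \<Longrightarrow> row (Suc u) = row u"
  using row_step[OF row_inside[of u]] by (auto simp: turns_def)

lemma row_const:
  assumes "u \<le> u'" "u' \<le> a" "\<And>w. u \<le> w \<Longrightarrow> w < u' \<Longrightarrow> w \<notin> turns"
  shows "row u' = row u"
  using assms
proof (induction rule: dec_induct)
  case (step w)
  then show ?case using row_straight[of w] by simp
qed simp

lemma row_mono: "u \<le> u' \<Longrightarrow> u' \<le> a \<Longrightarrow> row u \<le> row u'"
proof (induction rule: dec_induct)
  case (step w)
  then have "row w \<le> row (Suc w)"
    using row_straight[of w] row_turn(2)[of w] by (cases "w \<in> turns") auto
  then show ?case using step by simp
qed simp

text \<open>
  In the columns before column \<open>a\<close> the beam goes straight exactly where it crosses one of the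
  beams that start below it.
\<close>

lemma card_turns: "card turns = k"
proof -
  define S where "S = {u. u < a \<and> u * n + row u \<in> X}"
  have cell: "row u < n" "u < row u" if "u \<in> S" for u
    using that row_inside[of u] row_bounds[of u] k_pos by (auto simp: S_def)
  have up: "upper X (u * n + row u) = a" if "u \<in> S" for u
    using cell[OF that] hor_iff_row[of "row u" u] by (simp add: upper_time[OF XE])
  have "inj_on (\<lambda>u. lower X (u * n + row u)) S"
  proof (rule inj_onI)
    fix u w assume uw: "u \<in> S" "w \<in> S" "lower X (u * n + row u) = lower X (w * n + row w)"
    then have "touching X (u * n + row u) = touching X (w * n + row w)"
      using up by (simp add: touching_def)
    then have "u * n + row u = w * n + row w"
      using X uw by (auto simp: reduced_def inj_on_def S_def)
    then show "u = w" using cell uw by simp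
  qed
  moreover have "(\<lambda>u. lower X (u * n + row u)) ` S = {k..<a}"
  proof
    show "(\<lambda>u. lower X (u * n + row u)) ` S \<subseteq> {k..<a}"
    proof
      fix b assume "b \<in> (\<lambda>u. lower X (u * n + row u)) ` S"
      then obtain u where u: "u \<in> S" "b = lower X (u * n + row u)" by blast
      then have "u * n + row u \<in> X" by (simp add: S_def)
      then show "b \<in> {k..<a}"
        using reduced_lower_less_upper[OF X] up[OF u(1)] u(2) lower_upper_in_range(1)[OF XE] XE by fastforce
    qed
    show "{k..<a} \<subseteq> (\<lambda>u. lower X (u * n + row u)) ` S"
    proof
      fix b assume b: "b \<in> {k..<a}"
      have "a \<in> {k..<n - k}" "b \<in> {k..<n - k}" "a \<noteq> b" using a_lo a_hi b by auto
      then obtain t where t: "t \<in> X" "touching X t = {a, b}"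
        using reduced_crossing[OF X, of a b] by blast
      then have low: "lower X t = b" "upper X t = a"
        using reduced_lower_less_upper[OF X t(1)] b by (auto simp: touching_def doubleton_eq_iff)
      obtain x y where xy: "t = x * n + y" "y < n" "x + k < y" "y + k < x + n"
        using t(1) XE by (blast elim: relevant_timesE)
      then have r: "row x = y" using low(2) hor_iff_row[of y x] by (simp add: upper_time[OF XE])
      have "row x < n" using r xy by auto
      have "x \<le> a"
      proof (rule ccontr)
        assume "\<not> x \<le> a"
        then have "Suc a \<le> x" by simp
        then have "pos X (x * n) a = pos X (Suc a * n) a"
          using pos_outside[of "Suc a" "x * n"] row_exit mult_le_mono1[of "Suc a" x n] by simp
        then show False using \<open>row x < n\<close> \<open>Suc a \<le> x\<close> row_exit by (simp add: row_def)
      qed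
      moreover have "x \<noteq> a" using t(1) xy(1) r last_mirror(2) by auto
      ultimately have "x \<in> S" using t(1) xy(1) r by (simp add: S_def)
      then show "b \<in> (\<lambda>u. lower X (u * n + row u)) ` S" using low(1) xy(1) r by blast
    qed
  qed
  ultimately have "card S = a - k" using card_image by fastforce
  moreover have "{..<a} = S \<union> turns" "S \<inter> turns = {}" "finite S" "finite turns"
    by (auto simp: S_def turns_def)
  then have "a = card S + card turns" by (metis card_Un_disjoint card_lessThan)
  ultimately show ?thesis using a_lo by simp
qed

definition turn_list :: "nat list" where
  "turn_list = sorted_list_of_set turns"

text \<open>The middle vertex \<open>a\<close> plays two roles: it is the starting row of the beam
  and the column of its last mirror.\<close>

definition star :: "nat list" where
  "star = turn_list @ [a] @ map (\<lambda>u. row (Suc u)) turn_list"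

lemma finite_turns [simp]: "finite turns"
  by (simp add: turns_def)

lemma turn_list [simp]: "set turn_list = turns" "length turn_list = k" "sorted_wrt (<) turn_list"
  by (auto simp: turn_list_def card_turns strict_sorted_iff[symmetric])

lemma star_nth_le: "j \<le> k \<Longrightarrow> star ! j = (turn_list @ [a]) ! j"
  by (simp add: star_def nth_append)

lemma star_nth_column: "j < k \<Longrightarrow> star ! j \<in> turns"
  using nth_mem[of j turn_list] by (simp add: star_def nth_append)

lemma star_nth_middle: "star ! k = a"
  by (simp add: star_def nth_append)

lemma star_nth_row: "j < k \<Longrightarrow> star ! (k + j + 1) = row (Suc (star ! j))"
  by (simp add: star_def nth_append)

lemma star_nth_mono:
  assumes "i < j" "j \<le> k" shows "star ! i < star ! j"
proof (cases "j = k")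
  case True
  then show ?thesis using star_nth_column[of i] assms by (simp add: star_nth_middle turns_def)
next
  case False
  then show ?thesis using assms sorted_wrt_nth_less[OF turn_list(3), of i j]
    by (simp add: star_def nth_append)
qed

lemma star_column_le: "j \<le> k \<Longrightarrow> star ! j \<le> a"
  using star_nth_mono[of j k] by (cases "j = k") (auto simp: star_nth_middle)

lemma no_turn_between:
  assumes "j \<le> k" "w < star ! j" "j > 0 \<Longrightarrow> star ! (j - 1) < w"
  shows "w \<notin> turns"
proof
  assume "w \<in> turns"
  then obtain i where i: "i < k" "w = star ! i"
    by (metis in_set_conv_nth turn_list(1,2) star_nth_le less_imp_le nth_append)
  then have "i < j" using assms(1,2) star_nth_mono[of j i] by (cases i j rule: linorder_cases) auto
  moreover have "j - 1 < i" if "j > 0"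
  proof -
    have "j - 1 \<le> k" using assms(1) by simp
    then show ?thesis using assms(3)[OF that] i star_nth_mono[of i "j - 1"]
      by (cases i "j - 1" rule: linorder_cases) auto
  qed
  ultimately show False by linarith
qed

lemma row_star: "j \<le> k \<Longrightarrow> row (star ! j) = star ! (k + j)"
proof (cases j)
  case 0
  have "row (star ! 0) = row 0"
    by (rule row_const) (use no_turn_between[of 0] star_column_le[of 0] in auto)
  then show ?thesis using 0 by (simp add: star_nth_middle)
next
  case (Suc i)
  assume j: "j \<le> k"
  have "row (star ! j) = row (Suc (star ! i))"
    by (rule row_const) (use no_turn_between[of j] star_column_le[of j] star_nth_mono[of i j] Suc j in auto)
  then show ?thesis using star_nth_row[of i] Suc j by simp
qed

lemma star_sorted: "sorted_wrt (<) star"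
proof -
  have rows: "row (Suc (turn_list ! i)) < row (Suc (turn_list ! j))" if "i < j" "j < k" for i j
  proof -
    have t: "turn_list ! j \<in> turns" using nth_mem[of j turn_list] that by simp
    have "turn_list ! i < turn_list ! j"
      using sorted_wrt_nth_less[OF turn_list(3), of i j] that by simp
    then have "row (Suc (turn_list ! i)) \<le> row (turn_list ! j)"
      using t by (intro row_mono) (auto simp: turns_def)
    then show ?thesis using row_turn(2)[OF t] by simp
  qed
  then have "sorted_wrt (<) (map (\<lambda>u. row (Suc u)) turn_list)"
    by (simp add: sorted_wrt_iff_nth_less)
  moreover have "u < a \<and> a < row (Suc u)" if "u \<in> turns" for u
    using row_turn(2)[OF that] row_mono[of 0 u] that by (simp add: turns_def)
  ultimately show ?thesis
    by (auto simp: star_def sorted_wrt_append) (meson less_trans)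
qed

lemma star_is_star: "k_star_of n k (edges_of X) star"
  unfolding k_star_of_def
proof (intro conjI)
  show len: "length star = 2 * k + 1" by (simp add: star_def)
  show "sorted_wrt (<) star" by (rule star_sorted)
  show "set star \<subseteq> {..<n}"
    using a_hi row_turn(3) by (auto simp: star_def turns_def)
  show "star_edges k star \<subseteq> edges_of X"
  proof
    fix e assume "e \<in> star_edges k star"
    then consider j where "j \<le> k" "e = (star ! j, star ! (k + j))"
      | j where "j < k" "e = (star ! j, star ! (k + j + 1))"
      unfolding star_edges_eq[OF len star_sorted] by blast
    then show "e \<in> edges_of X"
    proof cases
      case (1 j)
      then have "e = (star ! j, row (star ! j))" using row_star by simp
      then show ?thesis
        using row_turn(1)[OF star_nth_column[of j]] last_mirror(1) 1(1)
        by (cases "j = k") (auto simp: star_nth_middle)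
    next
      case (2 j)
      then show ?thesis using star_nth_row[of j] row_turn(4)[OF star_nth_column[of j]] by simp
    qed
  qed
qed

lemma nth_star_eq:
  assumes "a = k - 1 + i" shows "nth_star n k (edges_of X) i = star"
  unfolding nth_star_def
proof (rule the_equality)
  show "k_star_of n k (edges_of X) star \<and> star ! k = k - 1 + i"
    using star_is_star star_nth_middle assms by simp
  fix s assume "k_star_of n k (edges_of X) s \<and> s ! k = k - 1 + i"
  then show "s = star"
    using star_unique[OF crossing_free_edges_of[OF X] _ star_is_star] star_nth_middle assms by simp
qed

text \<open>\<open>beam_coord\<close> cuts the region between the beam and its starting row into
  rectangles, one for each stretch between consecutive turns. The same area is summed here column by
  column.\<close>

lemma area_up_to_column:
  assumes "j \<le> k"
  shows "(\<Sum>u<star ! j. real (row (Suc u)) - real a) =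
    (\<Sum>i<j. (real (star ! Suc i) - real (star ! i)) * (real (star ! (k + i + 1)) - real a))"
  using assms
proof (induction j)
  case 0
  have "row (Suc u) = a" if "u < star ! 0" for u
    using row_const[of 0 "Suc u"] no_turn_between[of 0] star_column_le[of 0] that by auto
  then show ?case by simp
next
  case (Suc j)
  have less: "star ! j < star ! Suc j" using star_nth_mono Suc.prems by simp
  have "row (Suc u) = star ! (k + j + 1)" if "star ! j \<le> u" "u < star ! Suc j" for u
  proof -
    have "row (Suc u) = row (Suc (star ! j))"
      by (rule row_const)
        (use no_turn_between[of "Suc j"] star_column_le[of "Suc j"] that Suc.prems in auto)
    then show ?thesis using star_nth_row[of j] Suc.prems by simp
  qed
  then have "(\<Sum>u\<in>{star ! j..<star ! Suc j}. real (row (Suc u)) - real a) =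
      (real (star ! Suc j) - real (star ! j)) * (real (star ! (k + j + 1)) - real a)"
    using less by (simp add: of_nat_diff)
  moreover have "(\<Sum>u<star ! Suc j. real (row (Suc u)) - real a) =
      (\<Sum>u<star ! j. real (row (Suc u)) - real a) +
      (\<Sum>u\<in>{star ! j..<star ! Suc j}. real (row (Suc u)) - real a)"
  proof -
    have "{..<star ! Suc j} = {..<star ! j} \<union> {star ! j..<star ! Suc j}" using less by auto
    then show ?thesis by (simp add: sum.union_disjoint ivl_disj_int)
  qed
  ultimately show ?case using Suc by simp
qed

lemma beam_coord_eq_sum:
  assumes "a = k - 1 + i"
  shows "beam_coord n k (edges_of X) i = (\<Sum>u<a. real (row (Suc u)) - real a)"
proof -
  have "beam_coord n k (edges_of X) i =
      (\<Sum>j = 1..k. (real (star ! j) - real (star ! (j - 1))) * (real (star ! (k + j)) - real a))"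
    by (simp add: beam_coord_def nth_star_eq[OF assms] star_nth_middle Let_def)
  also have "\<dots> = (\<Sum>j<k. (real (star ! Suc j) - real (star ! j)) * (real (star ! (k + j + 1)) - real a))"
    by (rule sum.reindex_bij_witness[of _ Suc "\<lambda>j. j - 1"]) auto
  also have "\<dots> = (\<Sum>u<a. real (row (Suc u)) - real a)"
    using area_up_to_column[of k] by (simp add: star_nth_middle)
  finally show ?thesis .
qed

text \<open>The correction depends on \<open>a\<close> but not on \<open>X\<close>: before column
  \<open>a\<close>, rows and levels differ by the column number, and from the end of column
  \<open>a\<close> on, the level is constantly \<open>n - Suc a\<close>.\<close>

lemma beam_coord_eq_area:
  assumes "a = k - 1 + i"
  shows "beam_coord n k (edges_of X) i = area X a +
    ((\<Sum>u<a. real (Suc u) - real a) - real (n - a) * real (n - Suc a))"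
proof -
  have "area X a = (\<Sum>t\<in>column_ends. real (pos X t a))"
    by (rule area_def)
  also have "\<dots> = (\<Sum>u<n. real (pos X (Suc u * n) a))"
    unfolding column_ends_def
    by (subst sum.reindex) (use n_large in \<open>auto simp: inj_on_def\<close>)
  also have "\<dots> = (\<Sum>u<a. real (pos X (Suc u * n) a)) + (\<Sum>u\<in>{a..<n}. real (pos X (Suc u * n) a))"
  proof -
    have "{..<n} = {..<a} \<union> {a..<n}" using a_hi by auto
    then show ?thesis by (simp add: sum.union_disjoint ivl_disj_int del: mult_Suc)
  qed
  also have "(\<Sum>u\<in>{a..<n}. real (pos X (Suc u * n) a)) = (\<Sum>u\<in>{a..<n}. real (n - Suc a))"
  proof (rule sum.cong)
    fix u assume "u \<in> {a..<n}"
    then have "Suc a * n \<le> Suc u * n" by (intro mult_le_mono1) simp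
    then have "pos X (Suc u * n) a = pos X (Suc a * n) a"
      by (rule pos_outside[rotated]) (simp add: row_exit)
    also have "\<dots> = n - Suc a" using row_exit by (simp add: row_def del: mult_Suc)
    finally show "real (pos X (Suc u * n) a) = real (n - Suc a)" by simp
  qed simp
  finally have "area X a = (\<Sum>u<a. real (pos X (Suc u * n) a)) + real (n - a) * real (n - Suc a)"
    by (simp del: mult_Suc of_nat_diff)
  moreover have "(\<Sum>u<a. real (row (Suc u)) - real a) =
      (\<Sum>u<a. real (pos X (Suc u * n) a)) + (\<Sum>u<a. real (Suc u) - real a)"
    unfolding sum.distrib[symmetric] by (rule sum.cong) (auto simp: row_def simp del: mult_Suc)
  ultimately show ?thesis using beam_coord_eq_sum[OF assms] by simp
qed

end

section \<open>The cone at a vertex\<close>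

lemma convex_cone_cone_at:
  assumes "convex P" "p \<in> P" shows "convex_cone (cone_at P p)"
proof -
  have "cone_at P p = conic hull ((\<lambda>x. x - p) ` P)"
    by (auto simp: cone_at_def conic_hull_explicit)
  moreover have "convex ((\<lambda>x. x - p) ` P)"
    using convex_translation[OF assms(1), of "- p"] by simp
  ultimately show ?thesis
    using assms(2) by (auto simp: convex_cone_def conic_conic_hull convex_conic_hull conic_hull_eq_empty)
qed

context polygon
begin

section \<open>The beams among the mirrors and the oriented dual\<close>

lemma mirror_iff:
  assumes "x + k \<le> y" "y < n"
  shows "(int x, int y) \<in> mirrors (edges_of X) \<longleftrightarrow> x * n + y \<notin> X"
  using assms k_pos by (auto simp: mirrors_def edges_of_def polygon_edges_def)

lemma hor_in_range:
  assumes "X \<subseteq> relevant_times" "x + k \<le> y" "y + k < x + n"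
  shows "hor X x y \<in> {k..<n - k}"
  unfolding hor_def state_in_range[OF assms(1)] using assms(2,3) by auto

lemma ver_in_range:
  assumes "X \<subseteq> relevant_times" "x + k < y" "y + k \<le> x + n"
  shows "ver X x y \<in> {k..<n - k}"
  unfolding ver_def state_in_range[OF assms(1)] using assms(2,3) by auto

text \<open>Beam \<open>i\<close> starts in row \<open>k - 1 + i\<close>, so the line named
  \<open>a\<close> is the beam \<open>a + 1 - k\<close>.\<close>

lemma beam_arrives_complete:
  assumes X: "X \<subseteq> relevant_times"
  shows "(x + k \<le> y \<and> y + k < x + n \<and> y < n \<longrightarrow>
      beam_arrives k (edges_of X) (hor X x y + 1 - k) (int x, int y) Rightward) \<and>
    (x + k < y \<and> y + k \<le> x + n \<and> y \<le> n \<longrightarrow>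
      beam_arrives k (edges_of X) (ver X x y + 1 - k) (int x, int y) Upward)"
proof (rule beam_induct)
  fix y assume y: "k \<le> y" "y + k < n"
  have "beam_arrives k (edges_of X) (y + 1 - k) (- 1, int k - 1 + int (y + 1 - k)) Rightward"
    by (rule beam_arrives.start) simp
  moreover have "(- 1, int k - 1 + int (y + 1 - k)) \<notin> mirrors (edges_of X)" by (auto simp: mirrors_def)
  ultimately have "beam_arrives k (edges_of X) (y + 1 - k) (- 1 + 1, int k - 1 + int (y + 1 - k)) Rightward"
    by (rule beam_arrives.right_pass)
  moreover have "int k - 1 + int (y + 1 - k) = int y" using y by simp
  ultimately show "beam_arrives k (edges_of X) (hor X 0 y + 1 - k) (int 0, int y) Rightward"
    using hor_0[OF X, of y] y by simp
next
  fix x y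
  assume xy: "y < n" "x + k < y" "y + k \<le> x + n"
    and V: "beam_arrives k (edges_of X) (ver X x y + 1 - k) (int x, int y) Upward"
    and H: "y + k < x + n \<Longrightarrow> beam_arrives k (edges_of X) (hor X x y + 1 - k) (int x, int y) Rightward"
  have m: "(int x, int y) \<in> mirrors (edges_of X) \<longleftrightarrow> x * n + y \<notin> X" using mirror_iff xy by simp
  have "beam_arrives k (edges_of X) (hor X (Suc x) y + 1 - k) (int x + 1, int y) Rightward"
  proof (cases "x * n + y \<in> X")
    case True
    then show ?thesis
      using beam_arrives.right_pass[OF H] m time_in_X[OF X xy(1) True] xy by (simp add: hor_Suc[OF X])
  next
    case False
    then show ?thesis using beam_arrives.up_reflect[OF V] m xy by (simp add: hor_Suc[OF X])
  qed
  then show "beam_arrives k (edges_of X) (hor X (Suc x) y + 1 - k) (int (Suc x), int y) Rightward"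
    by (simp add: add.commute)
next
  fix x y
  assume xy: "y < n" "x + k \<le> y" "y + k < x + n"
    and H: "beam_arrives k (edges_of X) (hor X x y + 1 - k) (int x, int y) Rightward"
    and V: "x + k < y \<Longrightarrow> beam_arrives k (edges_of X) (ver X x y + 1 - k) (int x, int y) Upward"
  have m: "(int x, int y) \<in> mirrors (edges_of X) \<longleftrightarrow> x * n + y \<notin> X" using mirror_iff xy by simp
  have "beam_arrives k (edges_of X) (ver X x (Suc y) + 1 - k) (int x, int y + 1) Upward"
  proof (cases "x * n + y \<in> X")
    case True
    then show ?thesis
      using beam_arrives.up_pass[OF V] m time_in_X[OF X xy(1) True] xy by (simp add: ver_Suc[OF X])
  next
    case False
    then show ?thesis using beam_arrives.right_reflect[OF H] m xy by (simp add: ver_Suc[OF X])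
  qed
  then show "beam_arrives k (edges_of X) (ver X x (Suc y) + 1 - k) (int x, int (Suc y)) Upward"
    by (simp add: add.commute)
qed

text \<open>An invariant for the induction over \<open>beam_arrives\<close>. Nothing more is
  recorded from row \<open>n\<close> on, because there are no mirrors there and the beam never turns
  back.\<close>

fun arrival_place :: "nat set \<Rightarrow> nat \<Rightarrow> int \<times> int \<Rightarrow> direction \<Rightarrow> bool" where
  "arrival_place X a (p, q) Rightward \<longleftrightarrow> (p < 0 \<and> q = int a) \<or>
    (\<exists>x y. p = int x \<and> q = int y \<and> x + k \<le> y \<and> y + k < x + n \<and> y < n \<and> hor X x y = a)"
| "arrival_place X a (p, q) Upward \<longleftrightarrow> q \<ge> int n \<or>
    (\<exists>x y. p = int x \<and> q = int y \<and> x + k < y \<and> y + k \<le> x + n \<and> y < n \<and> ver X x y = a)"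

lemma arrival_place_right:
  "\<lbrakk>x + k \<le> y; y + k < x + n; y < n; hor X x y = a\<rbrakk> \<Longrightarrow> arrival_place X a (int x, int y) Rightward"
  by auto

lemma arrival_place_up:
  "\<lbrakk>x + k < y; y + k \<le> x + n; ver X x y = a\<rbrakk> \<Longrightarrow> arrival_place X a (int x, int y) Upward"
  by (cases "y < n") auto

lemma beam_arrives_sound:
  assumes X: "X \<subseteq> relevant_times" and a: "a = k - 1 + i" "k \<le> a" "a + k < n"
    and arr: "beam_arrives k (edges_of X) i pq d"
  shows "arrival_place X a pq d"
  using arr
proof (induction rule: beam_arrives.induct)
  case (start p)
  have "int k - 1 + int i = int a" using a(1) k_pos by simp
  then show ?case using start by simp
next
  case (right_pass p q)
  from right_pass.IH consider "p < 0" "q = int a"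
    | x y where "p = int x" "q = int y" "x + k \<le> y" "y + k < x + n" "y < n" "hor X x y = a" by auto
  then show ?case
  proof cases
    case 1
    show ?thesis
    proof (cases "p = - 1")
      case True
      then show ?thesis using arrival_place_right[of 0 a X a] hor_0[OF X, of a] a 1 by simp
    qed (use 1 in simp)
  next
    case (2 x y)
    then have "x * n + y \<in> X" using right_pass.hyps mirror_iff[of x y X] by simp
    then have "x + k < y" "hor X (Suc x) y = a"
      using time_in_X[OF X, of y x] 2 by (auto simp: hor_Suc[OF X])
    then have "arrival_place X a (int (Suc x), int y) Rightward"
      using 2 by (intro arrival_place_right) auto
    then show ?thesis using 2 by (simp only: of_nat_Suc add.commute)
  qed
next
  case (right_reflect p q)
  from right_reflect.hyps obtain x y where xy: "p = int x" "q = int y" by (auto simp: mirrors_def)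
  with right_reflect.IH have *: "x + k \<le> y" "y + k < x + n" "y < n" "hor X x y = a" by auto
  then have "x * n + y \<notin> X" using right_reflect.hyps mirror_iff[of x y X] xy by simp
  then have "arrival_place X a (int x, int (Suc y)) Upward"
    using * by (intro arrival_place_up) (auto simp: ver_Suc[OF X])
  then show ?case using xy by (simp only: of_nat_Suc add.commute)
next
  case (up_pass p q)
  from up_pass.IH consider "q \<ge> int n"
    | x y where "p = int x" "q = int y" "x + k < y" "y + k \<le> x + n" "y < n" "ver X x y = a" by auto
  then show ?case
  proof cases
    case (2 x y)
    then have "x * n + y \<in> X" using up_pass.hyps mirror_iff[of x y X] by simp
    then have "y + k < x + n" "ver X x (Suc y) = a"
      using time_in_X[OF X, of y x] 2 by (auto simp: ver_Suc[OF X])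
    then have "arrival_place X a (int x, int (Suc y)) Upward"
      using 2 by (intro arrival_place_up) auto
    then show ?thesis using 2 by (simp only: of_nat_Suc add.commute)
  qed simp
next
  case (up_reflect p q)
  from up_reflect.hyps obtain x y where xy: "p = int x" "q = int y" "y < n"
    by (auto simp: mirrors_def edges_of_def polygon_edges_def)
  with up_reflect.IH have *: "x + k < y" "y + k \<le> x + n" "ver X x y = a" by auto
  then have "x * n + y \<notin> X" using up_reflect.hyps mirror_iff[of x y X] xy by simp
  then have "arrival_place X a (int (Suc x), int y) Rightward"
    using * xy by (intro arrival_place_right) (auto simp: hor_Suc[OF X])
  then show ?case using xy by (simp only: of_nat_Suc add.commute)
qed

lemma arriving_beam_Rightward:
  assumes X: "X \<subseteq> relevant_times" and xy: "x + k < y" "y + k < x + n" "y < n"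
  shows "arriving_beam n k (edges_of X) Rightward (x, y) = hor X x y + 1 - k"
  unfolding arriving_beam_def prod.case
proof (rule the_equality)
  have "hor X x y \<in> {k..<n - k}" using hor_in_range[OF X] xy by simp
  then show "hor X x y + 1 - k \<in> {1..n - 2 * k} \<and>
      beam_arrives k (edges_of X) (hor X x y + 1 - k) (int x, int y) Rightward"
    using beam_arrives_complete[OF X, of x y] xy by auto
  fix i assume i: "i \<in> {1..n - 2 * k} \<and> beam_arrives k (edges_of X) i (int x, int y) Rightward"
  then have "k \<le> k - 1 + i" "k - 1 + i + k < n" using k_pos n_large by auto
  then have "arrival_place X (k - 1 + i) (int x, int y) Rightward"
    using beam_arrives_sound[OF X refl] i by blast
  then show "i = hor X x y + 1 - k" using k_pos by auto
qed

lemma arriving_beam_Upward: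
  assumes X: "X \<subseteq> relevant_times" and xy: "x + k < y" "y + k < x + n" "y < n"
  shows "arriving_beam n k (edges_of X) Upward (x, y) = ver X x y + 1 - k"
  unfolding arriving_beam_def prod.case
proof (rule the_equality)
  have "ver X x y \<in> {k..<n - k}" using ver_in_range[OF X] xy by simp
  then show "ver X x y + 1 - k \<in> {1..n - 2 * k} \<and>
      beam_arrives k (edges_of X) (ver X x y + 1 - k) (int x, int y) Upward"
    using beam_arrives_complete[OF X, of x y] xy by auto
  fix i assume i: "i \<in> {1..n - 2 * k} \<and> beam_arrives k (edges_of X) i (int x, int y) Upward"
  then have "k \<le> k - 1 + i" "k - 1 + i + k < n" using k_pos n_large by auto
  then have "arrival_place X (k - 1 + i) (int x, int y) Upward"
    using beam_arrives_sound[OF X refl] i by blast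
  then show "i = ver X x y + 1 - k" using k_pos xy by auto
qed

section \<open>Linear functionals on the beam vectors and the two cones\<close>

definition arc_vector :: "(nat \<Rightarrow> 'm::finite) \<Rightarrow> nat set \<Rightarrow> nat \<Rightarrow> real ^ 'm" where
  "arc_vector ix X t = axis (ix (lower X t + 1 - k)) 1 - axis (ix (upper X t + 1 - k)) 1"

lemma incidence_cone_eq:
  assumes X: "X \<subseteq> relevant_times"
  shows "incidence_cone ix (oriented_dual n k (edges_of X)) =
    convex_cone hull (arc_vector ix X ` (relevant_times - X))"
proof -
  let ?G = "oriented_dual n k (edges_of X)"
  have arc: "(x, y) \<in> arcs ?G \<longleftrightarrow> y < n \<and> x + k < y \<and> y + k < x + n \<and> x * n + y \<notin> X" for x y
    using n_large by (auto simp: oriented_dual_def k_relevant_def edges_of_def polygon_edges_def)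
  have vec: "axis (ix (tail ?G (x, y))) 1 - axis (ix (head ?G (x, y))) 1 = arc_vector ix X (x * n + y)"
    if "y < n" "x + k < y" "y + k < x + n" for x y
    using that arriving_beam_Upward[OF X] arriving_beam_Rightward[OF X]
    by (simp add: oriented_dual_def arc_vector_def lower_time[OF X] upper_time[OF X])
  have "{axis (ix (tail ?G a)) 1 - axis (ix (head ?G a)) 1 | a. a \<in> arcs ?G} =
      arc_vector ix X ` (relevant_times - X)" (is "?L = ?R")
  proof
    show "?L \<subseteq> ?R"
    proof
      fix z assume "z \<in> ?L"
      then obtain x y where xy: "(x, y) \<in> arcs ?G"
        "z = axis (ix (tail ?G (x, y))) 1 - axis (ix (head ?G (x, y))) 1" by auto
      then show "z \<in> ?R" using vec[of y x] unfolding arc by auto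
    qed
    show "?R \<subseteq> ?L"
    proof
      fix z assume "z \<in> ?R"
      then obtain t where t: "t \<in> relevant_times" "t \<notin> X" "z = arc_vector ix X t" by auto
      obtain x y where xy: "t = x * n + y" "y < n" "x + k < y" "y + k < x + n"
        using t(1) by (rule relevant_timesE)
      then have "(x, y) \<in> arcs ?G" using arc t by simp
      then show "z \<in> ?L" using vec[of y x] xy t(3) by force
    qed
  qed
  then show ?thesis by (simp only: incidence_cone_def)
qed

text \<open>\<open>K\<close> is the same for all arrangements, so differences of beam vectors are
  tested by differences of weights.\<close>

lemma inner_beam_vector:
  fixes ix :: "nat \<Rightarrow> 'm::finite"
  obtains K where "\<And>X. reduced X \<Longrightarrow>
    z \<bullet> beam_vector ix n k (edges_of X) = weight (\<lambda>c. z $ ix (c + 1 - k)) X + K"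
proof
  define C where "C = (\<lambda>c. (\<Sum>u<c. real (Suc u) - real c) - real (n - c) * real (n - Suc c))"
  fix X assume X: "reduced X"
  have "z \<bullet> beam_vector ix n k (edges_of X) =
      (\<Sum>i = 1..n - 2 * k. beam_coord n k (edges_of X) i * z $ ix i)"
    by (simp add: beam_vector_def inner_sum_right inner_axis)
  also have "\<dots> = (\<Sum>c\<in>{k..<n - k}. beam_coord n k (edges_of X) (c + 1 - k) * z $ ix (c + 1 - k))"
    by (rule sum.reindex_bij_witness[of _ "\<lambda>c. c + 1 - k" "\<lambda>i. k - 1 + i"])
      (use k_pos n_large in auto)
  also have "\<dots> = (\<Sum>c\<in>{k..<n - k}. z $ ix (c + 1 - k) * area X c + z $ ix (c + 1 - k) * C c)"
  proof (rule sum.cong)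
    fix c assume c: "c \<in> {k..<n - k}"
    interpret beam n k X c by unfold_locales (use X c in auto)
    have "beam_coord n k (edges_of X) (c + 1 - k) = area X c + C c"
      unfolding C_def by (rule beam_coord_eq_area) (use c k_pos in auto)
    then show "beam_coord n k (edges_of X) (c + 1 - k) * z $ ix (c + 1 - k) =
        z $ ix (c + 1 - k) * area X c + z $ ix (c + 1 - k) * C c"
      by (simp add: algebra_simps)
  qed simp
  also have "\<dots> = weight (\<lambda>c. z $ ix (c + 1 - k)) X + (\<Sum>c\<in>{k..<n - k}. z $ ix (c + 1 - k) * C c)"
    by (simp add: weight_def sum.distrib)
  finally show "z \<bullet> beam_vector ix n k (edges_of X) =
    weight (\<lambda>c. z $ ix (c + 1 - k)) X + (\<Sum>c\<in>{k..<n - k}. z $ ix (c + 1 - k) * C c)" .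
qed

lemma inner_arc_vector:
  "z \<bullet> arc_vector ix X t = z $ ix (lower X t + 1 - k) - z $ ix (upper X t + 1 - k)"
  by (simp add: arc_vector_def inner_diff_right inner_axis)

text \<open>\<open>Y\<close> and \<open>\<delta>\<close> come from a flip that works for all
  weights, so the vector equation can be tested against every \<open>z\<close>.\<close>

lemma beam_vector_flip:
  assumes X: "reduced X" and t: "t \<in> relevant_times - X"
  obtains Y \<delta> where "reduced Y" "\<delta> > 0"
    "beam_vector ix n k (edges_of Y) - beam_vector ix n k (edges_of X) = \<delta> *\<^sub>R arc_vector ix X t"
proof -
  obtain Y \<delta> where Y: "reduced Y" "\<delta> > 0"
    "\<And>f. weight f Y = weight f X + \<delta> * (f (lower X t) - f (upper X t))"
    using weight_flip[OF X t] by metis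
  have "z \<bullet> (beam_vector ix n k (edges_of Y) - beam_vector ix n k (edges_of X)) =
      z \<bullet> (\<delta> *\<^sub>R arc_vector ix X t)" for z
  proof -
    obtain K where K: "\<And>X. reduced X \<Longrightarrow>
        z \<bullet> beam_vector ix n k (edges_of X) = weight (\<lambda>c. z $ ix (c + 1 - k)) X + K"
      using inner_beam_vector[of z ix] by blast
    show ?thesis by (simp add: inner_diff_right K[OF X] K[OF Y(1)] Y(3) inner_arc_vector)
  qed
  then have "beam_vector ix n k (edges_of Y) - beam_vector ix n k (edges_of X) = \<delta> *\<^sub>R arc_vector ix X t"
    using vector_eq_ldot by blast
  then show ?thesis using that Y by blast
qed

lemma beam_vector_diff_in_cone:
  assumes X: "reduced X" and Y: "reduced Y"
  shows "beam_vector ix n k (edges_of Y) - beam_vector ix n k (edges_of X) \<in>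
    convex_cone hull (arc_vector ix X ` (relevant_times - X))" (is "?d \<in> ?C")
proof (rule ccontr)
  assume "?d \<notin> ?C"
  moreover have "finite (arc_vector ix X ` (relevant_times - X))" by simp
  then have "closed ?C" by (rule closed_convex_cone_hull)
  ultimately obtain z b where z: "z \<bullet> ?d < b" "\<forall>x\<in>?C. b < z \<bullet> x"
    using separating_hyperplane_closed_point[OF convex_convex_cone_hull] by blast
  have "b < 0" using z(2) convex_cone_hull_contains_0 by fastforce
  have nonneg: "0 \<le> z \<bullet> x" if "x \<in> ?C" for x
  proof (rule ccontr)
    assume neg: "\<not> 0 \<le> z \<bullet> x"
    \<comment> \<open>Scaling \<open>x\<close> until its inner product with \<open>z\<close> is
      exactly \<open>b\<close> violates the strict bound on the cone.\<close>
    then have "(b / (z \<bullet> x)) *\<^sub>R x \<in> ?C"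
      using that \<open>b < 0\<close> by (intro convex_cone_hull_mul) (auto simp: divide_nonpos_neg)
    then have "b < z \<bullet> ((b / (z \<bullet> x)) *\<^sub>R x)" using z(2) by blast
    then show False using neg by simp
  qed
  \<comment> \<open>\<open>z\<close> is nonnegative on the arcs, so it is \<open>- z\<close> that
    does not decrease from the lower to the upper beam.\<close>
  have "\<forall>t\<in>relevant_times - X.
      - (z $ ix (lower X t + 1 - k)) \<le> - (z $ ix (upper X t + 1 - k))"
  proof
    fix t assume "t \<in> relevant_times - X"
    then have "arc_vector ix X t \<in> ?C" by (intro hull_inc) simp
    from nonneg[OF this] show "- (z $ ix (lower X t + 1 - k)) \<le> - (z $ ix (upper X t + 1 - k))"
      by (simp add: inner_arc_vector)
  qed
  from weight_maximal[OF X this Y]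
  have "weight (\<lambda>c. (- z) $ ix (c + 1 - k)) Y \<le> weight (\<lambda>c. (- z) $ ix (c + 1 - k)) X" by simp
  moreover obtain K where K: "\<And>X. reduced X \<Longrightarrow>
      (- z) \<bullet> beam_vector ix n k (edges_of X) = weight (\<lambda>c. (- z) $ ix (c + 1 - k)) X + K"
    using inner_beam_vector[of "- z" ix] by blast
  ultimately have "(- z) \<bullet> beam_vector ix n k (edges_of Y) \<le> (- z) \<bullet> beam_vector ix n k (edges_of X)"
    by (simp only: K[OF X] K[OF Y])
  then show False using z(1) \<open>b < 0\<close> by (simp add: inner_diff_right)
qed

end

theorem theorem1p3p20:
  fixes n k :: nat and T :: "edge set" and ix :: "nat \<Rightarrow> 'm::finite"
  assumes "k \<ge> 1" and "n \<ge> 2 * k + 1"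
    and "bij_betw ix {1..n - 2 * k} (UNIV :: 'm set)"
    and "k_triangulation n k T"
  shows "cone_at (beam_polytope ix n k) (beam_vector ix n k T)
       = incidence_cone ix (oriented_dual n k T)"
proof -
  interpret polygon n k using assms by unfold_locales
  obtain X where X: "reduced X" "T = edges_of X"
    using assms(4) k_triangulation_iff_reduced by blast
  have XE: "X \<subseteq> relevant_times" using X(1) by (simp add: reduced_def)
  let ?p = "beam_vector ix n k T"
  let ?C = "convex_cone hull (arc_vector ix X ` (relevant_times - X))"
  have P: "beam_polytope ix n k = convex hull {beam_vector ix n k (edges_of Y) | Y. reduced Y}"
    unfolding beam_polytope_def k_triangulation_iff_reduced
    by (rule arg_cong[where f = "\<lambda>S. convex hull S"]) auto
  have convex: "convex (beam_polytope ix n k)" by (simp add: P)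
  have vertex: "beam_vector ix n k (edges_of Y) \<in> beam_polytope ix n k" if "reduced Y" for Y
    unfolding P by (rule hull_inc) (use that in blast)
  have "cone_at (beam_polytope ix n k) ?p = ?C"
  proof
    \<comment> \<open>The translated cone is convex, so only the beam vectors themselves need to be
      tested.\<close>
    have "beam_polytope ix n k \<subseteq> (\<lambda>x. x + ?p) ` ?C"
      unfolding P
    proof (rule hull_minimal)
      show "convex ((\<lambda>x. x + ?p) ` ?C)"
        using convex_translation[OF convex_convex_cone_hull, of ?p] by (simp add: add.commute)
      show "{beam_vector ix n k (edges_of Y) | Y. reduced Y} \<subseteq> (\<lambda>x. x + ?p) ` ?C"
        using beam_vector_diff_in_cone[OF X(1)] X(2) by force
    qed
    then show "cone_at (beam_polytope ix n k) ?p \<subseteq> ?C"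
      by (force simp: cone_at_def intro: convex_cone_hull_mul)
    show "?C \<subseteq> cone_at (beam_polytope ix n k) ?p"
    proof (rule hull_minimal)
      show "convex_cone (cone_at (beam_polytope ix n k) ?p)"
        using convex_cone_cone_at convex vertex[OF X(1)] X(2) by blast
      show "arc_vector ix X ` (relevant_times - X) \<subseteq> cone_at (beam_polytope ix n k) ?p"
      proof
        fix z assume "z \<in> arc_vector ix X ` (relevant_times - X)"
        then obtain t where t: "t \<in> relevant_times - X" "z = arc_vector ix X t" by blast
        obtain Y \<delta> where Y: "reduced Y" "\<delta> > 0"
          "beam_vector ix n k (edges_of Y) - ?p = \<delta> *\<^sub>R z"
          using beam_vector_flip[OF X(1) t(1)] X(2) t(2) by metis
        then have "z = (1 / \<delta>) *\<^sub>R (beam_vector ix n k (edges_of Y) - ?p)" by simp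
        then show "z \<in> cone_at (beam_polytope ix n k) ?p"
          using vertex[OF Y(1)] Y(2) unfolding cone_at_def by fastforce
      qed
    qed
  qed
  then show ?thesis using incidence_cone_eq[OF XE, of ix] X(2) by simp
qed

end
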